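(* (i) If $\bar p=(p(1),p(2),\dots)$, $0\le p(i)\le1$, contains only finitely many non-zero terms, then $\mathrm{Prob}(n,\bar p;\psi)$ converges as $n\to\infty$ for every first order sentence $\psi$ from $L_{\le}$. (ii) For every infinite sequence $\bar a=(a(1),a(2),\dots)$ with $0<a(i)\le 1$ for $i=1,2,\dots$, and every constant $\epsilon>0$, there exist a sequence $\bar p$ obtained from $\bar a$ by addition of some zero terms and a first order sentence $\psi$ from $L_{\le}$ such that $$\limsup_{n\to\infty}\mathrm{Prob}(n,\bar p;\psi)=1\quad\text{and}\quad \liminf_{n\to\infty}\mathrm{Prob}(n,\bar p;\psi)\le\epsilon.$$
   Context: For a sequence $\bar p=(p(1),p(2),\dots)$ with $0\le p(i)\le 1$, $G(n,\bar p)$ is the random graph with vertex set $[n]=\{1,\dots,n\}$ in which each pair of distinct vertices $v,w$ is an edge with probability $p(|v-w|)$, independently for each pair. $L_{\le}$ is first order logic with equality, a binary adjacency predicate and a binary predicate "$x\le y$". $\mathrm{Prob}(n,\bar p;\psi)$ denotes the probability that the sentence $\psi$ holds in the structure with universe $[n]$ whose adjacency relation is given by $G(n,\bar p)$ and whose predicate $\le$ is the usual order on $[n]$. A sequence $\bar p$ is obtained from $\bar a$ by addition of zero terms if there is a strictly increasing function $f:\{1,2,\dots\}\to\{1,2,\dots\}$ with $p(f(i))=a(i)$ for all $i$ and $p(j)=0$ for every $j$ not in the image of $f$. *)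

theory Defs
  imports "HOL-Probability.Probability"
begin

text \<open>
  Variables are named by natural numbers. The remaining connectives and the universal quantifier
  are expressible from negation, conjunction and existential quantification as usual.
\<close>

datatype fm =
    Eq nat nat
  | Adj nat nat
  | Le nat nat
  | Neg fm
  | Conj fm fm
  | Ex nat fm

fun fv :: "fm \<Rightarrow> nat set" where
  "fv (Eq x y) = {x, y}"
| "fv (Adj x y) = {x, y}"
| "fv (Le x y) = {x, y}"
| "fv (Neg \<phi>) = fv \<phi>"
| "fv (Conj \<phi> \<psi>) = fv \<phi> \<union> fv \<psi>"
| "fv (Ex x \<phi>) = fv \<phi> - {x}"

definition sentence :: "fm \<Rightarrow> bool" where
  "sentence \<phi> \<longleftrightarrow> fv \<phi> = {}"

fun sat ::
  "'a set \<Rightarrow> ('a \<Rightarrow> 'a \<Rightarrow> bool) \<Rightarrow> ('a \<Rightarrow> 'a \<Rightarrow> bool) \<Rightarrow> (nat \<Rightarrow> 'a) \<Rightarrow> fm \<Rightarrow> bool" where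
  "sat U E R \<sigma> (Eq x y) \<longleftrightarrow> \<sigma> x = \<sigma> y"
| "sat U E R \<sigma> (Adj x y) \<longleftrightarrow> E (\<sigma> x) (\<sigma> y)"
| "sat U E R \<sigma> (Le x y) \<longleftrightarrow> R (\<sigma> x) (\<sigma> y)"
| "sat U E R \<sigma> (Neg \<phi>) \<longleftrightarrow> \<not> sat U E R \<sigma> \<phi>"
| "sat U E R \<sigma> (Conj \<phi> \<psi>) \<longleftrightarrow> sat U E R \<sigma> \<phi> \<and> sat U E R \<sigma> \<psi>"
| "sat U E R \<sigma> (Ex x \<phi>) \<longleftrightarrow> (\<exists>u\<in>U. sat U E R (\<sigma>(x := u)) \<phi>)"

lemma sat_cong_fv:
  assumes "\<And>x. x \<in> fv \<phi> \<Longrightarrow> \<sigma> x = \<tau> x"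
  shows "sat U E R \<sigma> \<phi> \<longleftrightarrow> sat U E R \<tau> \<phi>"
  using assms
proof (induction \<phi> arbitrary: \<sigma> \<tau>)
  case (Conj \<phi> \<psi>)
  have "sat U E R \<sigma> \<phi> \<longleftrightarrow> sat U E R \<tau> \<phi>" by (rule Conj.IH(1)) (use Conj.prems in simp)
  moreover have "sat U E R \<sigma> \<psi> \<longleftrightarrow> sat U E R \<tau> \<psi>" by (rule Conj.IH(2)) (use Conj.prems in simp)
  ultimately show ?case by simp
next
  case (Neg \<phi>)
  have "sat U E R \<sigma> \<phi> \<longleftrightarrow> sat U E R \<tau> \<phi>" by (rule Neg.IH) (use Neg.prems in simp)
  then show ?case by simp
next
  case (Ex x \<phi>)
  have "sat U E R (\<sigma>(x := u)) \<phi> \<longleftrightarrow> sat U E R (\<tau>(x := u)) \<phi>" for u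
    by (rule Ex.IH) (use Ex.prems in auto)
  then show ?case by simp
qed simp_all

lemma sat_sentence:
  "sentence \<phi> \<Longrightarrow> sat U E R \<sigma> \<phi> \<longleftrightarrow> sat U E R \<tau> \<phi>"
  by (rule sat_cong_fv) (simp add: sentence_def)

text \<open>
  Each unordered pair of distinct vertices is encoded as \<open>(v, w)\<close> with \<open>v < w\<close>. Every other pair,
  in particular \<open>(v, v)\<close>, takes the default value \<open>False\<close>, so the adjacency relation obtained is
  symmetric and irreflexive and holds only between vertices in \<open>{1..n}\<close>.
\<close>

definition vertex_pairs :: "nat \<Rightarrow> (nat \<times> nat) set" where
  "vertex_pairs n = {(v, w). 1 \<le> v \<and> v < w \<and> w \<le> n}"

definition random_graph :: "nat \<Rightarrow> (nat \<Rightarrow> real) \<Rightarrow> (nat \<Rightarrow> nat \<Rightarrow> bool) pmf" where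
  "random_graph n p =
     map_pmf (\<lambda>X v w. X (min v w, max v w))
       (Pi_pmf (vertex_pairs n) False (\<lambda>(v, w). bernoulli_pmf (p (w - v))))"

text \<open>
  For a sentence the initial assignment \<open>\<lambda>_. 0\<close> is irrelevant, by lemma \<open>sat_sentence\<close>.
\<close>

definition Prob :: "nat \<Rightarrow> (nat \<Rightarrow> real) \<Rightarrow> fm \<Rightarrow> real" where
  "Prob n p \<psi> = measure_pmf.prob (random_graph n p) {E. sat {1..n} E (\<le>) (\<lambda>_. 0) \<psi>}"

text \<open>Sequences are indexed by the positive integers; their value at 0 is never used.\<close>

definition zero_extension_of :: "(nat \<Rightarrow> real) \<Rightarrow> (nat \<Rightarrow> real) \<Rightarrow> bool" where
  "zero_extension_of p a \<longleftrightarrow>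
     (\<exists>f. f \<in> {1..} \<rightarrow> {1..} \<and> strict_mono_on {1..} f \<and>
          (\<forall>i\<ge>1. p (f i) = a i) \<and> (\<forall>j\<ge>1. j \<notin> f ` {1..} \<longrightarrow> p j = 0))"

end

theory Submission
  imports Defs
begin

text \<open>
  \<^bold>\<open>Convergence.\<close> If only lengths up to \<open>K\<close> have positive probability, then the graph on \<open>{1..n}\<close> can be
  read off from a word of \<open>n\<close> independent, identically distributed letters, the letter of a vertex
  listing its edges to the \<open>K\<close> preceding vertices. A first order sentence about the ordered graph
  becomes a language of words. By induction on the formula, with variables represented by marks on
  letters, this language has a finite and aperiodic syntactic monoid (\<open>aperiodic_lang\<close>): quantification
  is the only critical step, and there it matters that one new mark breaks a high power of a word
  into two powers, one of which is still high. In such a monoid some word \<open>u\<close> absorbs everything that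
  stands between two of its occurrences (\<open>absorbing_word\<close>). Since \<open>u\<close> occurs near both ends of a long
  random word with probability close to 1, the middle of the word is irrelevant and the probabilities
  form a Cauchy sequence (\<open>convergent_prob_aperiodic\<close>).

  \<^bold>\<open>Oscillation.\<close> The positions \<open>f 1 < f 2 < \<dots>\<close> of the given probabilities grow very fast, except that
  \<open>f (2 * s) = 2 * f (2 * s - 1)\<close>. Then three mutually adjacent vertices are necessarily equally spaced,
  and two overlapping triangles, a ladder, form an arithmetic progression of four vertices with spacing
  \<open>d = f (2 * s - 1)\<close>. This allows a first order sentence to speak about one and the same scale at
  several places. The sentence says that there is a ladder \<open>v0 < v1 < v2 < v3\<close> without an edge from
  \<open>{..v1}\<close> to beyond \<open>v3\<close> and without an edge from before \<open>v0\<close> to \<open>{v2..}\<close>. Such an edge would be longer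
  than \<open>2 * d\<close>.

  If there are \<open>4 * d\<close> vertices with \<open>d = f (2 * s - 1)\<close>, then no edge is longer than \<open>2 * d\<close>, so any ladder
  of spacing \<open>d\<close> makes the sentence true, and there are \<open>d\<close> independent candidates for one
  (\<open>Prob_ladder_lower\<close>). If instead there are slightly more than \<open>f t\<close> vertices with \<open>t\<close> odd, then the
  single length \<open>f t\<close> is too long to take part in a ladder, but edges of this length join the two ends
  of the vertex set, and at every lower scale edges of much greater length start close to the left end
  and end close to the right end. Together they cross all ladders (\<open>Prob_ladder_upper\<close>). This
  needs one good event per level, and since \<open>f l\<close> is chosen after the relevant probabilities are known,
  the failure probabilities of all levels add up to at most \<open>\<epsilon>\<close>.
\<close>

section \<open>Aperiodic languages\<close>

text \<open>
  \<open>contexts L u\<close> names the class of \<open>u\<close> in the syntactic congruence of \<open>L\<close>: two words are congruent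
  iff they have the same set of contexts.
\<close>

definition contexts :: "'a list set \<Rightarrow> 'a list \<Rightarrow> ('a list \<times> 'a list) set" where
  "contexts L u = {(x, y). x @ u @ y \<in> L}"

definition lpow :: "'a list \<Rightarrow> nat \<Rightarrow> 'a list" where
  "lpow v n = concat (replicate n v)"

lemma lpow_0 [simp]: "lpow v 0 = []"
  and lpow_Suc [simp]: "lpow v (Suc n) = v @ lpow v n"
  by (simp_all add: lpow_def)

lemma lpow_add: "lpow v (m + n) = lpow v m @ lpow v n"
  by (induction m) simp_all

lemma lpow_Suc2: "lpow v (Suc n) = lpow v n @ v"
  using lpow_add[of v n 1] by simp

lemma lpow_map: "lpow (map f v) n = map f (lpow v n)"
  by (induction n) simp_all

text \<open>
  A language of finite words whose syntactic monoid is finite and satisfies \<open>v ^ (N + 1) = v ^ N\<close> for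
  some \<open>N\<close>. Over a finite alphabet these are exactly the languages that first order logic can define.
  The alphabet may be infinite, which is harmless because only the number of classes matters.
\<close>

definition aperiodic :: "'a list set \<Rightarrow> bool" where
  "aperiodic L \<longleftrightarrow> finite (range (contexts L)) \<and>
     (\<exists>N. \<forall>v. contexts L (lpow v (Suc N)) = contexts L (lpow v N))"

lemma contexts_mem: "u \<in> L \<longleftrightarrow> ([], []) \<in> contexts L u"
  by (simp add: contexts_def)

lemma contexts_cong:
  assumes "contexts L u = contexts L u'"
  shows "contexts L (x @ u @ y) = contexts L (x @ u' @ y)"
proof -
  have "(p @ x) @ u @ (y @ q) \<in> L \<longleftrightarrow> (p @ x) @ u' @ (y @ q) \<in> L" for p q
    using assms unfolding contexts_def by blast
  then show ?thesis by (simp add: contexts_def)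
qed

lemma contexts_append:
  assumes "contexts L u = contexts L u'" "contexts L v = contexts L v'"
  shows "contexts L (u @ v) = contexts L (u' @ v')"
  using contexts_cong[OF assms(1), of "[]" v] contexts_cong[OF assms(2), of u' "[]"] by simp

lemma contexts_lpow_stable:
  assumes "\<And>v. contexts L (lpow v (Suc N)) = contexts L (lpow v N)" "n \<ge> N"
  shows "contexts L (lpow v n) = contexts L (lpow v N)"
  using assms(2)
proof (induction n rule: dec_induct)
  case (step n)
  have "contexts L (lpow v (Suc n)) = contexts L (lpow v (Suc N))"
    using contexts_append[OF refl step.IH] by simp
  then show ?case using assms(1) by simp
qed simp

text \<open>
  Any map \<open>h\<close> into a finite set that respects concatenation, determines membership and identifies two
  consecutive high powers refines the syntactic congruence. This spares the closure proofs below any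
  knowledge of the exact syntactic congruence of the new language.
\<close>

lemma aperiodicI:
  fixes h :: "'a list \<Rightarrow> 'b"
  assumes fin: "finite (range h)"
    and app: "\<And>u u' v v'. h u = h u' \<Longrightarrow> h v = h v' \<Longrightarrow> h (u @ v) = h (u' @ v')"
    and sat: "\<And>u u'. h u = h u' \<Longrightarrow> u \<in> L \<longleftrightarrow> u' \<in> L"
    and per: "\<And>v. h (lpow v (Suc N)) = h (lpow v N)"
  shows "aperiodic L"
proof -
  have c: "contexts L u = contexts L u'" if "h u = h u'" for u u'
  proof -
    have "h (x @ u @ y) = h (x @ u' @ y)" for x y by (intro app that refl)
    then show ?thesis using sat unfolding contexts_def by blast
  qed
  have "contexts L u = contexts L (inv h (h u))" for u
    by (rule c) (simp add: f_inv_into_f)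
  then have "range (contexts L) \<subseteq> (contexts L \<circ> inv h) ` range h" by auto
  then have "finite (range (contexts L))" using fin finite_surj by blast
  then show ?thesis unfolding aperiodic_def using c[OF per] by blast
qed

lemma aperiodic_vimage_map:
  assumes "aperiodic L"
  shows "aperiodic {w. map f w \<in> L}"
proof -
  obtain N where N: "\<And>v. contexts L (lpow v (Suc N)) = contexts L (lpow v N)"
    using assms unfolding aperiodic_def by blast
  show ?thesis
  proof (rule aperiodicI[where h = "\<lambda>w. contexts L (map f w)" and N = N])
    show "finite (range (\<lambda>w. contexts L (map f w)))"
      by (rule finite_subset[of _ "range (contexts L)"]) (use assms aperiodic_def in auto)
    show "contexts L (map f (u @ v)) = contexts L (map f (u' @ v'))"
      if "contexts L (map f u) = contexts L (map f u')" "contexts L (map f v) = contexts L (map f v')"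
      for u u' v v'
      using contexts_append[OF that] by simp
    show "u \<in> {w. map f w \<in> L} \<longleftrightarrow> u' \<in> {w. map f w \<in> L}"
      if "contexts L (map f u) = contexts L (map f u')" for u u'
      using that contexts_mem[of "map f u" L] contexts_mem[of "map f u'" L] by simp
    show "contexts L (map f (lpow v (Suc N))) = contexts L (map f (lpow v N))" for v
      using N[of "map f v"] by (simp add: lpow_map)
  qed
qed

lemma aperiodic_Compl:
  assumes "aperiodic L"
  shows "aperiodic (- L)"
proof -
  have "contexts (- L) = (\<lambda>u. - contexts L u)" by (auto simp: contexts_def fun_eq_iff)
  then have "range (contexts (- L)) = uminus ` range (contexts L)"
    and "contexts (- L) u = contexts (- L) v \<longleftrightarrow> contexts L u = contexts L v" for u v by auto
  then show ?thesis using assms unfolding aperiodic_def by simp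
qed

lemma aperiodic_Int:
  assumes "aperiodic L" "aperiodic M"
  shows "aperiodic (L \<inter> M)"
proof -
  obtain N K where N: "\<And>v. contexts L (lpow v (Suc N)) = contexts L (lpow v N)"
    and K: "\<And>v. contexts M (lpow v (Suc K)) = contexts M (lpow v K)"
    using assms unfolding aperiodic_def by blast
  show ?thesis
  proof (rule aperiodicI[where h = "\<lambda>w. (contexts L w, contexts M w)" and N = "max N K"])
    show "finite (range (\<lambda>w. (contexts L w, contexts M w)))"
      by (rule finite_subset[of _ "range (contexts L) \<times> range (contexts M)"])
        (use assms aperiodic_def in auto)
    show "(contexts L (lpow v (Suc (max N K))), contexts M (lpow v (Suc (max N K)))) =
        (contexts L (lpow v (max N K)), contexts M (lpow v (max N K)))" for v
      using contexts_lpow_stable[of L N "Suc (max N K)" v] contexts_lpow_stable[of L N "max N K" v]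
        contexts_lpow_stable[of M K "Suc (max N K)" v] contexts_lpow_stable[of M K "max N K" v] N K
      by (simp del: lpow_Suc)
    show "(contexts L (u @ v), contexts M (u @ v)) = (contexts L (u' @ v'), contexts M (u' @ v'))"
      if "(contexts L u, contexts M u) = (contexts L u', contexts M u')"
        "(contexts L v, contexts M v) = (contexts L v', contexts M v')" for u u' v v'
      using that contexts_append[of L u u' v v'] contexts_append[of M u u' v v'] by simp
    show "u \<in> L \<inter> M \<longleftrightarrow> u' \<in> L \<inter> M"
      if "(contexts L u, contexts M u) = (contexts L u', contexts M u')" for u u'
      using that contexts_mem[of u L] contexts_mem[of u' L] contexts_mem[of u M] contexts_mem[of u' M]
      by simp
  qed
qed

lemma aperiodic_Un: "aperiodic L \<Longrightarrow> aperiodic M \<Longrightarrow> aperiodic (L \<union> M)"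
  using aperiodic_Compl[OF aperiodic_Int[OF aperiodic_Compl aperiodic_Compl]] by simp

lemma aperiodic_empty: "aperiodic {}"
  by (simp add: aperiodic_def contexts_def)

lemma aperiodic_UN: "finite I \<Longrightarrow> (\<And>i. i \<in> I \<Longrightarrow> aperiodic (L i)) \<Longrightarrow> aperiodic (\<Union>i\<in>I. L i)"
  by (induction I rule: finite_induct) (auto intro: aperiodic_Un aperiodic_empty)

section \<open>First order constructions\<close>

text \<open>
  The atomic formulas are evaluated on words by looking for a letter satisfying \<open>A\<close> and a letter
  satisfying \<open>B\<close>, either at an exact distance (equality and adjacency) or in weak order.
\<close>

definition at_distance :: "nat \<Rightarrow> ('a \<Rightarrow> bool) \<Rightarrow> ('a \<Rightarrow> bool) \<Rightarrow> 'a list set" where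
  "at_distance d A B = {w. \<exists>i. i + d < length w \<and> A (w ! i) \<and> B (w ! (i + d))}"

text \<open>
  A pair of letters at distance \<open>d\<close> that straddles the cut between \<open>u\<close> and \<open>v\<close> has its first letter
  among the last \<open>d\<close> of \<open>u\<close> and its second among the first \<open>d\<close> of \<open>v\<close>. Hence these bounded windows,
  the one of \<open>u\<close> being read backwards, are all that a concatenation has to remember.
\<close>

definition prefix_hits :: "nat \<Rightarrow> ('a \<Rightarrow> bool) \<Rightarrow> 'a list \<Rightarrow> nat set" where
  "prefix_hits d B w = {j. j < d \<and> j < length w \<and> B (w ! j)}"

lemma prefix_hits_append:
  "prefix_hits d B (u @ v) =
     prefix_hits d B u \<union> {j. min (length u) d \<le> j \<and> j < d \<and> j - min (length u) d \<in> prefix_hits d B v}"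
  by (auto simp: prefix_hits_def nth_append min_def not_less split: if_splits)

lemma prefix_hits_append_long:
  "d \<le> length u \<Longrightarrow> prefix_hits d B (u @ v) = prefix_hits d B u"
  by (auto simp: prefix_hits_def nth_append)

lemma at_distance_append:
  "u @ v \<in> at_distance d A B \<longleftrightarrow> u \<in> at_distance d A B \<or> v \<in> at_distance d A B \<or>
     (\<exists>j\<in>prefix_hits d A (rev u). \<exists>k\<in>prefix_hits d B v. j + k + 1 = d)" (is "?l \<longleftrightarrow> ?r")
proof
  assume ?l
  then obtain i where i: "i + d < length u + length v" "A ((u @ v) ! i)" "B ((u @ v) ! (i + d))"
    by (auto simp: at_distance_def)
  consider "i + d < length u" | "length u \<le> i" | "i < length u" "length u \<le> i + d" by linarith
  then show ?r
  proof cases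
    case 1
    then show ?thesis using i by (auto simp: at_distance_def nth_append)
  next
    case 2
    then have "i - length u + d < length v" "A (v ! (i - length u))" "B (v ! (i - length u + d))"
      using i by (auto simp: nth_append)
    then show ?thesis unfolding at_distance_def by blast
  next
    case 3
    have "length u - 1 - i \<in> prefix_hits d A (rev u)"
      using i 3 by (auto simp: prefix_hits_def nth_append rev_nth)
    moreover have "i + d - length u \<in> prefix_hits d B v"
      using i 3 by (auto simp: prefix_hits_def nth_append)
    moreover have "(length u - 1 - i) + (i + d - length u) + 1 = d" using 3 by simp
    ultimately show ?thesis by blast
  qed
next
  assume ?r
  then consider "u \<in> at_distance d A B" | "v \<in> at_distance d A B"
    | j k where "j \<in> prefix_hits d A (rev u)" "k \<in> prefix_hits d B v" "j + k + 1 = d" by blast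
  then show ?l
  proof cases
    case 1
    then obtain i where "i + d < length u" "A (u ! i)" "B (u ! (i + d))"
      by (auto simp: at_distance_def)
    then show ?thesis by (auto simp: at_distance_def nth_append intro!: exI[of _ i])
  next
    case 2
    then obtain i where "i + d < length v" "A (v ! i)" "B (v ! (i + d))"
      by (auto simp: at_distance_def)
    then show ?thesis
      by (auto simp: at_distance_def nth_append add.assoc intro!: exI[of _ "length u + i"])
  next
    case 3
    then have "j < length u" "A (u ! (length u - 1 - j))" "k < length v" "B (v ! k)"
      by (auto simp: prefix_hits_def rev_nth)
    moreover have "length u - 1 - j + d = length u + k" using 3 \<open>j < length u\<close> by simp
    ultimately show ?thesis
      by (auto simp: at_distance_def nth_append intro!: exI[of _ "length u - 1 - j"])
  qed
qed

lemma length_lpow: "length (lpow v n) = n * length v"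
  by (induction n) simp_all

text \<open>
  For a nonempty \<open>v\<close> the windows of \<open>lpow v n\<close> stop changing once \<open>n \<ge> d\<close>. One more power later the
  set of straddling pairs has stopped changing as well.
\<close>

lemma aperiodic_at_distance: "aperiodic (at_distance d A B)"
proof -
  define h where "h w = (min (length w) d, prefix_hits d B w, prefix_hits d A (rev w),
      w \<in> at_distance d A B)" for w
  show ?thesis
  proof (rule aperiodicI[where h = h and N = "Suc d"])
    have "range h \<subseteq> {..d} \<times> Pow {..<d} \<times> Pow {..<d} \<times> UNIV"
      by (auto simp: h_def prefix_hits_def)
    then show "finite (range h)" by (rule finite_subset) auto
    show "h (u @ v) = h (u' @ v')" if "h u = h u'" "h v = h v'" for u u' v v'
    proof -
      have "min (length (u @ v)) d = min (min (length u) d + min (length v) d) d" for u v :: "'a list"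
        by auto
      then show ?thesis
        using that by (simp add: h_def at_distance_append prefix_hits_append)
    qed
    show "u \<in> at_distance d A B \<longleftrightarrow> u' \<in> at_distance d A B" if "h u = h u'" for u u'
      using that by (simp add: h_def)
    show "h (lpow v (Suc (Suc d))) = h (lpow v (Suc d))" for v
    proof (cases "v = []")
      case False
      have len: "d \<le> length (lpow v n)" if "d \<le> n" for n
        using that False mult_le_mono[of d n 1 "length v"] by (simp add: length_lpow Suc_le_eq)
      have B: "prefix_hits d B (lpow v (Suc n)) = prefix_hits d B (lpow v n)" if "d \<le> n" for n
        unfolding lpow_Suc2 by (rule prefix_hits_append_long) (rule len[OF that])
      have A: "prefix_hits d A (rev (lpow v (Suc n))) = prefix_hits d A (rev (lpow v n))" if "d \<le> n" for n
        unfolding lpow_Suc rev_append by (rule prefix_hits_append_long) (simp add: len[OF that])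
      have "lpow v (Suc (Suc d)) \<in> at_distance d A B \<longleftrightarrow> lpow v (Suc d) \<in> at_distance d A B"
        using A[of d] at_distance_append[of "lpow v (Suc d)" v d A B]
          at_distance_append[of "lpow v d" v d A B]
        unfolding lpow_Suc2[of v "Suc d", symmetric] lpow_Suc2[of v d, symmetric]
        by (simp del: lpow_Suc)
      then show ?thesis
        using A[of "Suc d"] B[of "Suc d"] len[of "Suc d"] len[of "Suc (Suc d)"]
        by (simp add: h_def del: lpow_Suc)
    qed (simp add: lpow_def)
  qed
qed

definition in_order :: "('a \<Rightarrow> bool) \<Rightarrow> ('a \<Rightarrow> bool) \<Rightarrow> 'a list set" where
  "in_order A B = {w. \<exists>i j. i \<le> j \<and> j < length w \<and> A (w ! i) \<and> B (w ! j)}"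

lemma in_order_append:
  "u @ v \<in> in_order A B \<longleftrightarrow> u \<in> in_order A B \<or> v \<in> in_order A B \<or>
     ((\<exists>a\<in>set u. A a) \<and> (\<exists>b\<in>set v. B b))" (is "?l \<longleftrightarrow> ?r")
proof
  assume ?l
  then obtain i j where i: "i \<le> j" "j < length u + length v" "A ((u @ v) ! i)" "B ((u @ v) ! j)"
    by (auto simp: in_order_def)
  consider "j < length u" | "length u \<le> i" | "i < length u" "length u \<le> j" by linarith
  then show ?r
  proof cases
    case 1
    then show ?thesis using i by (auto simp: in_order_def nth_append)
  next
    case 2
    then have "i - length u \<le> j - length u" "j - length u < length v"
      "A (v ! (i - length u))" "B (v ! (j - length u))"
      using i by (auto simp: nth_append)
    then show ?thesis unfolding in_order_def by blast
  next
    case 3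
    then have "u ! i \<in> set u" "v ! (j - length u) \<in> set v" using i by auto
    then show ?thesis using i 3 by (auto simp: nth_append)
  qed
next
  assume ?r
  then consider "u \<in> in_order A B" | "v \<in> in_order A B"
    | a b where "a \<in> set u" "A a" "b \<in> set v" "B b" by blast
  then show ?l
  proof cases
    case 1
    then obtain i j where "i \<le> j" "j < length u" "A (u ! i)" "B (u ! j)"
      by (auto simp: in_order_def)
    then show ?thesis unfolding in_order_def mem_Collect_eq
      by - (rule exI[of _ i], rule exI[of _ j], auto simp: nth_append)
  next
    case 2
    then obtain i j where "i \<le> j" "j < length v" "A (v ! i)" "B (v ! j)"
      by (auto simp: in_order_def)
    then show ?thesis
      unfolding in_order_def mem_Collect_eq
      by - (rule exI[of _ "length u + i"], rule exI[of _ "length u + j"], auto simp: nth_append)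
  next
    case 3
    then obtain i j where "i < length u" "A (u ! i)" "j < length v" "B (v ! j)"
      by (auto simp: in_set_conv_nth)
    then show ?thesis
      unfolding in_order_def mem_Collect_eq
      by - (rule exI[of _ i], rule exI[of _ "length u + j"], auto simp: nth_append)
  qed
qed

lemma aperiodic_in_order: "aperiodic (in_order A B)"
  by (rule aperiodicI[where N = 2 and
        h = "\<lambda>w. (\<exists>a\<in>set w. A a, \<exists>b\<in>set w. B b, w \<in> in_order A B)"])
    (auto simp: in_order_append numeral_2_eq_2)

text \<open>
  Letters carry a set of variables, namely those whose value is the position of the letter. A
  quantifier over \<open>x\<close> erases all marks \<open>x\<close> and puts a single new one somewhere.
\<close>

definition unmark :: "nat \<Rightarrow> ('a \<times> nat set) list \<Rightarrow> ('a \<times> nat set) list" where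
  "unmark x = map (\<lambda>(a, S). (a, S - {x}))"

definition marked_at_one :: "nat \<Rightarrow> ('a \<times> nat set) list \<Rightarrow> ('a \<times> nat set) list set" where
  "marked_at_one x w = {unmark x u @ (a, insert x S) # unmark x v | u a S v. w = u @ (a, S) # v}"

lemma unmark_append: "unmark x (u @ v) = unmark x u @ unmark x v"
  by (simp add: unmark_def)

lemma marked_at_one_append:
  "marked_at_one x (u @ v) =
     (\<lambda>b. b @ unmark x v) ` marked_at_one x u \<union> (\<lambda>b. unmark x u @ b) ` marked_at_one x v"
  (is "?l = ?r")
proof
  show "?l \<subseteq> ?r"
  proof
    fix b assume "b \<in> ?l"
    then obtain p a S q where b: "b = unmark x p @ (a, insert x S) # unmark x q"
      and e: "u @ v = p @ (a, S) # q" unfolding marked_at_one_def by blast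
    from e consider s where "u = p @ (a, S) # s" "q = s @ v"
      | s where "p = u @ s" "v = s @ (a, S) # q"
      by (auto simp: append_eq_append_conv2 append_eq_Cons_conv Cons_eq_append_conv)
    then show "b \<in> ?r"
    proof cases
      case 1
      then have "unmark x p @ (a, insert x S) # unmark x s \<in> marked_at_one x u"
        unfolding marked_at_one_def by blast
      then show ?thesis using b 1 by (force simp: unmark_append)
    next
      case 2
      then have "unmark x s @ (a, insert x S) # unmark x q \<in> marked_at_one x v"
        unfolding marked_at_one_def by blast
      then show ?thesis using b 2 by (force simp: unmark_append)
    qed
  qed
  show "?r \<subseteq> ?l"
  proof
    fix b assume "b \<in> ?r"
    then consider p a S q where "b = unmark x p @ (a, insert x S) # unmark x q @ unmark x v" "u = p @ (a, S) # q"
      | p a S q where "b = unmark x u @ unmark x p @ (a, insert x S) # unmark x q" "v = p @ (a, S) # q"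
      unfolding marked_at_one_def by auto
    then show "b \<in> ?l"
    proof cases
      case 1
      then have "b = unmark x p @ (a, insert x S) # unmark x (q @ v)" "u @ v = p @ (a, S) # (q @ v)"
        by (simp_all add: unmark_append)
      then show ?thesis unfolding marked_at_one_def by blast
    next
      case 2
      then have "b = unmark x (u @ p) @ (a, insert x S) # unmark x q" "u @ v = (u @ p) @ (a, S) # q"
        by (simp_all add: unmark_append)
      then show ?thesis unfolding marked_at_one_def by blast
    qed
  qed
qed

lemma marked_at_one_Nil [simp]: "marked_at_one x [] = {}"
  by (simp add: marked_at_one_def)

lemma unmark_lpow: "unmark x (lpow v n) = lpow (unmark x v) n"
  by (simp add: unmark_def lpow_map)

lemma marked_at_one_lpow:
  "marked_at_one x (lpow v n) =
     {lpow (unmark x v) p @ b @ lpow (unmark x v) q | p b q. b \<in> marked_at_one x v \<and> p + q + 1 = n}"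
proof (induction n)
  case (Suc n)
  let ?c = "unmark x v"
  show ?case
  proof
    show "marked_at_one x (lpow v (Suc n)) \<subseteq>
        {lpow ?c p @ b @ lpow ?c q | p b q. b \<in> marked_at_one x v \<and> p + q + 1 = Suc n}" (is "_ \<subseteq> ?r")
    proof
      fix c assume "c \<in> marked_at_one x (lpow v (Suc n))"
      then consider b where "b \<in> marked_at_one x v" "c = b @ lpow ?c n"
        | p b q where "b \<in> marked_at_one x v" "p + q + 1 = n" "c = ?c @ lpow ?c p @ b @ lpow ?c q"
        by (auto simp: marked_at_one_append unmark_lpow Suc.IH)
      then show "c \<in> ?r"
      proof cases
        case 1
        then have "c = lpow ?c 0 @ b @ lpow ?c n" by simp
        then show ?thesis using 1 by force
      next
        case 2
        then have "c = lpow ?c (Suc p) @ b @ lpow ?c q" "Suc p + q + 1 = Suc n" by simp_all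
        then show ?thesis using 2(1) by blast
      qed
    qed
    show "?r \<subseteq> marked_at_one x (lpow v (Suc n))"
    proof
      fix c assume "c \<in> ?r"
      then obtain p b q where c: "b \<in> marked_at_one x v" "p + q + 1 = Suc n"
        "c = lpow ?c p @ b @ lpow ?c q" by blast
      show "c \<in> marked_at_one x (lpow v (Suc n))"
      proof (cases p)
        case 0
        then show ?thesis using c by (auto simp: marked_at_one_append unmark_lpow)
      next
        case (Suc p')
        then have "lpow ?c p' @ b @ lpow ?c q \<in> marked_at_one x (lpow v n)"
          unfolding Suc.IH using c by auto
        then show ?thesis using c Suc by (auto simp: marked_at_one_append unmark_lpow)
      qed
    qed
  qed
qed simp

text \<open>
  The word \<open>w\<close> is summarised by the class of its unmarked version together with the set of classes of
  all words obtained by marking one position. Marking one position of \<open>lpow v n\<close> leaves unmarked powers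
  of \<open>v\<close> on both sides. When \<open>n > 2 * N\<close> at least one of the two exponents is so large that it can be
  raised or lowered by one without leaving its class, so the set of classes does not change with \<open>n\<close>.
\<close>

lemma aperiodic_exists_mark:
  assumes "aperiodic L"
  shows "aperiodic {w. \<exists>b\<in>marked_at_one x w. b \<in> L}"
proof -
  obtain N where N: "\<And>v. contexts L (lpow v (Suc N)) = contexts L (lpow v N)"
    using assms unfolding aperiodic_def by blast
  define h where "h w = (contexts L (unmark x w), contexts L ` marked_at_one x w)" for w
  show ?thesis
  proof (rule aperiodicI[where h = h and N = "2 * N + 1"])
    have "range h \<subseteq> range (contexts L) \<times> Pow (range (contexts L))"
      by (auto simp: h_def)
    then show "finite (range h)"
      by (rule finite_subset) (use assms in \<open>simp add: aperiodic_def\<close>)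
    show "h (u @ v) = h (u' @ v')" if "h u = h u'" "h v = h v'" for u u' v v'
    proof -
      have sub: "contexts L ` marked_at_one x (u @ v) \<subseteq> contexts L ` marked_at_one x (u' @ v')"
        if "h u = h u'" "h v = h v'" for u u' v v'
      proof -
        have u: "contexts L (unmark x u) = contexts L (unmark x u')"
          and v: "contexts L (unmark x v) = contexts L (unmark x v')"
          using that by (simp_all add: h_def)
        have "\<exists>b'\<in>marked_at_one x u'. contexts L (b @ unmark x v) = contexts L (b' @ unmark x v')"
          if "b \<in> marked_at_one x u" for b
        proof -
          have "contexts L b \<in> contexts L ` marked_at_one x u'"
            using that \<open>h u = h u'\<close> by (auto simp: h_def)
          then obtain b' where "b' \<in> marked_at_one x u'" "contexts L b = contexts L b'" by blast
          then show ?thesis using contexts_append v by blast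
        qed
        moreover have "\<exists>b'\<in>marked_at_one x v'. contexts L (unmark x u @ b) = contexts L (unmark x u' @ b')"
          if "b \<in> marked_at_one x v" for b
        proof -
          have "contexts L b \<in> contexts L ` marked_at_one x v'"
            using that \<open>h v = h v'\<close> by (auto simp: h_def)
          then obtain b' where "b' \<in> marked_at_one x v'" "contexts L b = contexts L b'" by blast
          then show ?thesis using contexts_append u by blast
        qed
        ultimately show ?thesis
          unfolding marked_at_one_append image_Un image_image image_subset_iff Un_subset_iff
          unfolding image_iff ball_Un bex_Un Un_iff by metis
      qed
      have "contexts L (unmark x u @ unmark x v) = contexts L (unmark x u' @ unmark x v')"
        using that by (intro contexts_append) (simp_all add: h_def)
      then show ?thesis
        unfolding h_def unmark_append using sub[OF that] sub[OF that[symmetric]] by (simp add: subset_antisym)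
    qed
    show "u \<in> {w. \<exists>b\<in>marked_at_one x w. b \<in> L} \<longleftrightarrow> u' \<in> {w. \<exists>b\<in>marked_at_one x w. b \<in> L}"
      if "h u = h u'" for u u'
    proof -
      have "u \<in> {w. \<exists>b\<in>marked_at_one x w. b \<in> L} \<longleftrightarrow> (\<exists>C\<in>contexts L ` marked_at_one x u. ([], []) \<in> C)" for u
        using contexts_mem by auto
      moreover have "contexts L ` marked_at_one x u = contexts L ` marked_at_one x u'"
        using that by (simp add: h_def)
      ultimately show ?thesis by presburger
    qed
    show "h (lpow v (Suc (2 * N + 1))) = h (lpow v (2 * N + 1))" for v
    proof -
      let ?c = "unmark x v"
      have st: "contexts L (lpow ?c n) = contexts L (lpow ?c m)" if "n \<ge> N" "m \<ge> N" for n m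
        using contexts_lpow_stable[of L N, OF N] that by metis
      have *: "\<exists>p' q'. p' + q' + 1 = m \<and> contexts L (lpow ?c p @ b @ lpow ?c q) = contexts L (lpow ?c p' @ b @ lpow ?c q')"
        if pq: "p + q + 1 = n" "n \<ge> 2 * N + 1" "m \<ge> 2 * N + 1" "n \<le> m + 1" for p q n m b
      proof (cases "q \<le> N")
        case True
        then have "p \<ge> N" "m - q - 1 \<ge> N" using pq by auto
        then have "contexts L (lpow ?c p @ b @ lpow ?c q) = contexts L (lpow ?c (m - q - 1) @ b @ lpow ?c q)"
          by (intro contexts_append st refl)
        moreover have "m - q - 1 + q + 1 = m" using True pq by simp
        ultimately show ?thesis by blast
      next
        case False
        show ?thesis
        proof (cases "p \<le> N")
          case True
          then have "m - p - 1 \<ge> N" using pq by auto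
          then have "contexts L (lpow ?c p @ b @ lpow ?c q) = contexts L (lpow ?c p @ b @ lpow ?c (m - p - 1))"
            by (intro contexts_append st refl) (use False in simp)
          moreover have "p + (m - p - 1) + 1 = m" using True pq by simp
          ultimately show ?thesis by blast
        next
          case False2: False
          then have "contexts L (lpow ?c p @ b @ lpow ?c q) = contexts L (lpow ?c N @ b @ lpow ?c (m - N - 1))"
            by (intro contexts_append st refl) (use False pq in simp_all)
          moreover have "N + (m - N - 1) + 1 = m" using pq by simp
          ultimately show ?thesis by blast
        qed
      qed
      have sub: "contexts L ` marked_at_one x (lpow v n) \<subseteq> contexts L ` marked_at_one x (lpow v m)"
        if nm: "n \<ge> 2 * N + 1" "m \<ge> 2 * N + 1" "n \<le> m + 1" for n m
      proof
        fix C assume "C \<in> contexts L ` marked_at_one x (lpow v n)"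
        then obtain p b q where C: "C = contexts L (lpow ?c p @ b @ lpow ?c q)"
          and b: "b \<in> marked_at_one x v" "p + q + 1 = n"
          unfolding marked_at_one_lpow by blast
        then obtain p' q' where "p' + q' + 1 = m" "C = contexts L (lpow ?c p' @ b @ lpow ?c q')"
          using *[OF b(2) nm, of b] unfolding C by blast
        then show "C \<in> contexts L ` marked_at_one x (lpow v m)"
          unfolding marked_at_one_lpow using b by blast
      qed
      have "contexts L ` marked_at_one x (lpow v (Suc (2 * N + 1))) = contexts L ` marked_at_one x (lpow v (2 * N + 1))"
        by (intro equalityI sub) simp_all
      then show ?thesis unfolding h_def unmark_lpow using st[of "Suc (2 * N + 1)" "2 * N + 1"] by simp
    qed
  qed
qed

section \<open>Random words\<close>

text \<open>
  In the syntactic monoid the class of \<open>u\<close> lies in a minimal left ideal, which forces \<open>u\<close> to be of the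
  form \<open>p u g\<close>, up to congruence, with \<open>g = y u\<close>, for every \<open>y\<close>. Iterating gives \<open>p ^ n u g ^ n\<close>, and since the powers of
  \<open>g\<close> become constant, \<open>u g\<close> and \<open>u\<close> are congruent. So whatever stands between two occurrences of \<open>u\<close>
  can be deleted without affecting membership.
\<close>

lemma absorbing_word:
  assumes "aperiodic L"
  obtains u where "set u \<subseteq> \<Sigma>" "\<And>y. set y \<subseteq> \<Sigma> \<Longrightarrow> contexts L (u @ y @ u) = contexts L u"
proof -
  obtain N where N: "\<And>v. contexts L (lpow v (Suc N)) = contexts L (lpow v N)"
    and fin: "finite (range (contexts L))"
    using assms unfolding aperiodic_def by blast
  define I where "I u = {contexts L (x @ u) | x. set x \<subseteq> \<Sigma>}" for u
  have finI: "finite (I u)" for u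
    by (rule finite_subset[OF _ fin]) (auto simp: I_def)
  \<comment> \<open>The class of \<open>u\<close> generates a left ideal \<open>I u\<close> of least size.\<close>
  obtain u where u: "set u \<subseteq> \<Sigma>" and least: "\<And>v. set v \<subseteq> \<Sigma> \<Longrightarrow> card (I u) \<le> card (I v)"
    using ex_has_least_nat[of "\<lambda>u. set u \<subseteq> \<Sigma>" "[]" "\<lambda>u. card (I u)"] by auto
  have "contexts L (u @ y @ u) = contexts L u" if y: "set y \<subseteq> \<Sigma>" for y
  proof -
    have "I (u @ y @ u) \<subseteq> I u"
    proof
      fix C assume "C \<in> I (u @ y @ u)"
      then obtain x where "set x \<subseteq> \<Sigma>" "C = contexts L ((x @ u @ y) @ u)"
        by (auto simp: I_def)
      moreover from this have "set (x @ u @ y) \<subseteq> \<Sigma>" using u y by simp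
      ultimately show "C \<in> I u" unfolding I_def by blast
    qed
    then have "I (u @ y @ u) = I u"
      by (rule card_seteq[OF finI]) (use least u y in simp)
    moreover have "contexts L u \<in> I u"
      unfolding I_def by (intro CollectI exI[of _ "[]"]) simp
    ultimately have "contexts L u \<in> I (u @ y @ u)" by simp
    then obtain p where p: "contexts L (p @ u @ y @ u) = contexts L u"
      unfolding I_def by force
    define g where "g = y @ u"
    have pump: "contexts L (lpow p n @ u @ lpow g n) = contexts L u" for n
    proof (induction n)
      case (Suc n)
      have "contexts L (lpow p (Suc n) @ u @ lpow g (Suc n)) = contexts L (lpow p n @ (p @ u @ y @ u) @ lpow g n)"
        unfolding lpow_Suc2[of p] by (simp add: g_def)
      also have "\<dots> = contexts L (lpow p n @ u @ lpow g n)" by (rule contexts_cong[OF p])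
      finally show ?case using Suc.IH by simp
    qed simp
    have "contexts L (u @ g) = contexts L ((lpow p N @ u @ lpow g N) @ g)"
      by (rule contexts_append[OF pump[symmetric] refl])
    also have "\<dots> = contexts L (lpow p N @ (u @ lpow g (Suc N)))"
      unfolding lpow_Suc2 by simp
    also have "\<dots> = contexts L (lpow p N @ (u @ lpow g N))"
      by (intro contexts_append refl N)
    finally show ?thesis using pump by (simp add: g_def)
  qed
  with u show thesis by (rule that)
qed

lemma replicate_pmf_add:
  "replicate_pmf (m + n) q = map_pmf (\<lambda>(a, b). a @ b) (pair_pmf (replicate_pmf m q) (replicate_pmf n q))"
  unfolding replicate_pmf_distrib
  by (simp add: map_pmf_def pair_pmf_def bind_assoc_pmf bind_return_pmf)

lemma prob_pair_pmf_Times: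
  "measure_pmf.prob (pair_pmf M N) (A \<times> B) = measure_pmf.prob M A * measure_pmf.prob N B"
proof -
  have "measure_pmf.prob (pair_pmf M N) (A \<times> B) =
      measure_pmf.prob (pair_pmf M N) ((A \<inter> set_pmf M) \<times> (B \<inter> set_pmf N))"
    by (subst measure_Int_set_pmf[symmetric], intro arg_cong[where f = "measure_pmf.prob _"]) auto
  also have "\<dots> = measure_pmf.prob M (A \<inter> set_pmf M) * measure_pmf.prob N (B \<inter> set_pmf N)"
    by (intro measure_pmf_prob_product countable_Int2 countable_set_pmf)
  finally show ?thesis by (simp add: measure_Int_set_pmf)
qed

lemma prob_le_sum:
  assumes "\<And>x. x \<in> set_pmf P \<Longrightarrow> x \<in> A \<Longrightarrow> x \<in> B \<or> x \<in> C"
  shows "measure_pmf.prob P A \<le> measure_pmf.prob P B + measure_pmf.prob P C"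
proof -
  have "measure_pmf.prob P (A \<inter> set_pmf P) \<le> measure_pmf.prob P (B \<union> C)"
    by (rule measure_pmf.finite_measure_mono) (use assms in auto)
  also have "\<dots> \<le> measure_pmf.prob P B + measure_pmf.prob P C"
    by (rule measure_Un_le) auto
  finally show ?thesis by (simp add: measure_Int_set_pmf)
qed

definition avoiding :: "'a list \<Rightarrow> 'a list set" where
  "avoiding u = {w. \<nexists>x z. w = x @ u @ z}"

text \<open>
  Each further block of length \<open>length u\<close> is equal to \<open>u\<close> with the same positive probability.
\<close>

lemma prob_avoiding_small:
  assumes u: "set u \<subseteq> set_pmf q" and "e > 0"
  obtains n where "measure_pmf.prob (replicate_pmf n q) (avoiding u) < e"
proof -
  define \<delta> where "\<delta> = pmf (replicate_pmf (length u) q) u"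
  define b where "b n = measure_pmf.prob (replicate_pmf n q) (avoiding u)" for n
  have "\<delta> > 0"
    using u by (auto simp: \<delta>_def pmf_positive_iff set_replicate_pmf)
  have step: "b (length u + n) \<le> (1 - \<delta>) * b n" for n
  proof -
    have "b (length u + n) = measure_pmf.prob (pair_pmf (replicate_pmf (length u) q) (replicate_pmf n q))
        ((\<lambda>(a, c). a @ c) -` avoiding u)"
      by (simp add: b_def replicate_pmf_add)
    also have "\<dots> \<le> measure_pmf.prob (pair_pmf (replicate_pmf (length u) q) (replicate_pmf n q))
        ((- {u}) \<times> avoiding u)"
    proof (rule measure_pmf.finite_measure_mono)
      have "\<exists>x z. a @ x' @ u @ z' = x @ u @ z" for a x' z' :: "'a list"
        by (intro exI[of _ "a @ x'"] exI[of _ z']) simp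
      moreover have "\<exists>x z. u @ c = x @ u @ z" for c
        by (intro exI[of _ "[]"] exI[of _ c]) simp
      ultimately show "(\<lambda>(a, c). a @ c) -` avoiding u \<subseteq> (- {u}) \<times> avoiding u"
        unfolding avoiding_def by clarsimp metis
    qed simp
    also have "\<dots> = (1 - \<delta>) * b n"
      using measure_pmf.prob_compl[of "{u}" "replicate_pmf (length u) q"]
      by (simp add: prob_pair_pmf_Times b_def \<delta>_def Compl_eq_Diff_UNIV measure_pmf_single)
    finally show ?thesis .
  qed
  have d1: "\<delta> \<le> 1" by (simp add: \<delta>_def pmf_le_1)
  have pow: "b (k * length u) \<le> (1 - \<delta>) ^ k" for k
  proof (induction k)
    case (Suc k)
    have "b (Suc k * length u) \<le> (1 - \<delta>) * b (k * length u)" using step[of "k * length u"] by simp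
    also have "\<dots> \<le> (1 - \<delta>) * (1 - \<delta>) ^ k"
      by (rule mult_left_mono[OF Suc.IH]) (use d1 in simp)
    finally show ?case by simp
  qed (simp add: b_def)
  obtain k where "(1 - \<delta>) ^ k < e"
    using real_arch_pow_inv[OF \<open>e > 0\<close>, of "1 - \<delta>"] \<open>\<delta> > 0\<close> by auto
  then have "b (k * length u) < e" using pow[of k] by linarith
  then show thesis unfolding b_def by (rule that)
qed

text \<open>
  A long random word of length \<open>n\<close> is split as \<open>a y c\<close> with \<open>a\<close> and \<open>c\<close> of a fixed length \<open>N\<close>. If the
  absorbing word occurs in \<open>a\<close> and in \<open>c\<close>, then deleting \<open>y\<close> does not affect membership in \<open>L\<close>. Thus
  the probabilities for length \<open>n\<close> and for length \<open>2 * N\<close> differ at most by the probability that the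
  absorbing word is missing from \<open>a\<close> or from \<open>c\<close>, which tends to 0 as \<open>N\<close> grows.
\<close>

theorem convergent_prob_aperiodic:
  assumes "aperiodic L"
  shows "convergent (\<lambda>n. measure_pmf.prob (replicate_pmf n q) L)"
proof -
  define f where "f n = measure_pmf.prob (replicate_pmf n q) L" for n
  obtain u where u: "set u \<subseteq> set_pmf q"
    and absorb: "\<And>y. set y \<subseteq> set_pmf q \<Longrightarrow> contexts L (u @ y @ u) = contexts L u"
    using absorbing_word[OF assms] by blast
  have "Cauchy f"
  proof (rule CauchyI)
    fix e :: real assume "e > 0"
    then obtain N where N: "measure_pmf.prob (replicate_pmf N q) (avoiding u) < e / 4"
      using prob_avoiding_small[OF u, of "e / 4"] by auto
    define b where "b = measure_pmf.prob (replicate_pmf N q) (avoiding u)"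
    have close: "\<bar>f n - f (N + N)\<bar> < e / 2" if "n \<ge> N + N" for n
    proof -
      define k where "k = n - (N + N)"
      have n: "n = N + (k + N)" using that by (simp add: k_def)
      define P where "P = pair_pmf (replicate_pmf N q) (pair_pmf (replicate_pmf k q) (replicate_pmf N q))"
      define A where "A = {(a, y, c). a @ y @ c \<in> L}"
      define B where "B = {(a, y :: 'a list, c). a @ c \<in> L}"
      define bad where "bad = {(a, y :: 'a list, c). a \<in> avoiding u \<or> c \<in> avoiding u}"
      have "replicate_pmf n q = map_pmf (\<lambda>(a, y, c). a @ y @ c) P"
        unfolding n replicate_pmf_add P_def
        by (simp add: pair_map_pmf2 pmf.map_comp o_def case_prod_unfold apsnd_def)
      then have fn: "f n = measure_pmf.prob P A"
        by (simp add: f_def A_def vimage_def case_prod_unfold)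
      have "replicate_pmf (N + N) q = map_pmf (\<lambda>(a, y, c). a @ c) P"
      proof -
        have "pair_pmf (replicate_pmf N q) (replicate_pmf N q) =
            pair_pmf (replicate_pmf N q) (map_pmf snd (pair_pmf (replicate_pmf k q) (replicate_pmf N q)))"
          by (simp add: map_snd_pair_pmf)
        then show ?thesis
          unfolding replicate_pmf_add P_def
          by (simp only: pair_map_pmf2 pmf.map_comp o_def case_prod_unfold) (simp add: apsnd_def map_prod_def case_prod_unfold)
      qed
      then have fN: "f (N + N) = measure_pmf.prob P B"
        by (simp add: f_def B_def vimage_def case_prod_unfold)
      have agree: "(a, y, c) \<in> A \<longleftrightarrow> (a, y, c) \<in> B"
        if S: "(a, y, c) \<in> set_pmf P" and nb: "(a, y, c) \<notin> bad" for a y c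
      proof -
        from nb obtain x z x' z' where a: "a = x @ u @ z" and c: "c = x' @ u @ z'"
          unfolding bad_def avoiding_def by blast
        have sub: "set a \<subseteq> set_pmf q" "set y \<subseteq> set_pmf q" "set c \<subseteq> set_pmf q"
          using S by (auto simp: P_def set_replicate_pmf)
        have "contexts L (a @ y @ c) = contexts L (x @ (u @ (z @ y @ x') @ u) @ z')"
          by (simp add: a c)
        also have "\<dots> = contexts L (x @ (u @ (z @ x') @ u) @ z')"
          using sub by (intro contexts_cong[of L "u @ (z @ y @ x') @ u"]) (simp only: absorb a c set_append Un_subset_iff)
        also have "\<dots> = contexts L (a @ c)" by (simp add: a c)
        finally show ?thesis
          unfolding A_def B_def using contexts_mem[of "a @ y @ c" L] contexts_mem[of "a @ c" L] by simp
      qed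
      have "measure_pmf.prob P bad \<le> measure_pmf.prob P (avoiding u \<times> UNIV) + measure_pmf.prob P (UNIV \<times> UNIV \<times> avoiding u)"
        by (rule prob_le_sum) (auto simp: bad_def)
      also have "\<dots> = b + b"
        unfolding P_def prob_pair_pmf_Times by (simp add: b_def)
      finally have "measure_pmf.prob P bad < e / 2" using N by (simp add: b_def)
      moreover have "measure_pmf.prob P A \<le> measure_pmf.prob P B + measure_pmf.prob P bad"
        by (rule prob_le_sum) (metis agree prod_cases3)
      moreover have "measure_pmf.prob P B \<le> measure_pmf.prob P A + measure_pmf.prob P bad"
        by (rule prob_le_sum) (metis agree prod_cases3)
      ultimately show ?thesis unfolding fn fN by linarith
    qed
    have "norm (f m - f n) < e" if "m \<ge> N + N" "n \<ge> N + N" for m n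
      using close[OF that(1)] close[OF that(2)] unfolding real_norm_def by linarith
    then show "\<exists>M. \<forall>m\<ge>M. \<forall>n\<ge>M. norm (f m - f n) < e" by blast
  qed
  then show ?thesis unfolding f_def Cauchy_convergent_iff .
qed

section \<open>Random graphs with bounded edge lengths\<close>

text \<open>
  The letter of vertex \<open>j\<close> tells for each \<open>d\<close> whether \<open>j\<close> is joined to \<open>j - d\<close>. Vertices are numbered
  from 1 and list positions from 0, hence the index \<open>j - 1\<close>. Bits pointing to a vertex below 1 are
  ignored, which lets all letters have the same distribution.
\<close>

definition edge_of_word :: "nat \<Rightarrow> (nat \<Rightarrow> bool) list \<Rightarrow> nat \<times> nat \<Rightarrow> bool" where
  "edge_of_word K w = (\<lambda>(i, j). 1 \<le> i \<and> i < j \<and> j \<le> length w \<and> j - i \<le> K \<and> (w ! (j - 1)) (j - i))"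

text \<open>
  The words over marked letters that satisfy a formula.
\<close>

fun lang :: "nat \<Rightarrow> fm \<Rightarrow> ((nat \<Rightarrow> bool) \<times> nat set) list set" where
  "lang K (Eq x y) = at_distance 0 (\<lambda>(a, S). x \<in> S) (\<lambda>(a, S). y \<in> S)"
| "lang K (Adj x y) =
     (\<Union>d\<in>{1..K}. at_distance d (\<lambda>(a, S). x \<in> S) (\<lambda>(a, S). y \<in> S \<and> a d) \<union>
                  at_distance d (\<lambda>(a, S). y \<in> S) (\<lambda>(a, S). x \<in> S \<and> a d))"
| "lang K (Le x y) = in_order (\<lambda>(a, S). x \<in> S) (\<lambda>(a, S). y \<in> S)"
| "lang K (Neg \<phi>) = - lang K \<phi>"
| "lang K (Conj \<phi> \<psi>) = lang K \<phi> \<inter> lang K \<psi>"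
| "lang K (Ex x \<phi>) = {w. \<exists>b\<in>marked_at_one x w. b \<in> lang K \<phi>}"

lemma aperiodic_lang: "aperiodic (lang K \<phi>)"
  by (induction \<phi>)
    (simp_all add: aperiodic_at_distance aperiodic_in_order aperiodic_Compl aperiodic_Int
      aperiodic_exists_mark aperiodic_Un aperiodic_UN del: Un_iff)

text \<open>
  Variables that are sent outside \<open>{1..length w}\<close> mark no letter. In particular the assignment that is
  constantly 0 turns a word into its unmarked copy, which suits sentences.
\<close>

definition mark :: "(nat \<Rightarrow> nat) \<Rightarrow> 'a list \<Rightarrow> ('a \<times> nat set) list" where
  "mark \<sigma> w = map (\<lambda>i. (w ! i, {x. \<sigma> x = Suc i})) [0..<length w]"

lemma length_mark [simp]: "length (mark \<sigma> w) = length w"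
  and nth_mark [simp]: "i < length w \<Longrightarrow> mark \<sigma> w ! i = (w ! i, {x. \<sigma> x = Suc i})"
  by (simp_all add: mark_def)

lemma marked_at_one_mark:
  "marked_at_one x (mark \<sigma> w) = (\<lambda>v. mark (\<sigma>(x := v)) w) ` {1..length w}"
proof -
  have *: "unmark x u @ (a, insert x S) # unmark x v = mark (\<sigma>(x := Suc (length u))) w"
    if e: "mark \<sigma> w = u @ (a, S) # v" for u a S v
  proof (rule nth_equalityI)
    have len: "length w = length u + 1 + length v"
      using arg_cong[OF e, of length] by simp
    then show "length (unmark x u @ (a, insert x S) # unmark x v) = length (mark (\<sigma>(x := Suc (length u))) w)"
      by (simp add: unmark_def)
    fix i assume "i < length (unmark x u @ (a, insert x S) # unmark x v)"
    then have i: "i < length w" using len by (simp add: unmark_def)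
    have ui: "(u @ (a, S) # v) ! i = (w ! i, {x. \<sigma> x = Suc i})"
      using e i nth_mark by metis
    show "(unmark x u @ (a, insert x S) # unmark x v) ! i = mark (\<sigma>(x := Suc (length u))) w ! i"
    proof -
      consider "i < length u" | "i = length u" | k where "i = length u + Suc k" "k < length v"
      proof -
        have "i = length u + Suc (i - Suc (length u))" "i - Suc (length u) < length v"
          if "\<not> i < length u" "i \<noteq> length u"
          using that i len by linarith+
        then show ?thesis using that by blast
      qed
      then show ?thesis
      proof cases
        case 1
        then show ?thesis using ui i by (auto simp: nth_append unmark_def)
      next
        case 2
        then show ?thesis using ui i by (auto simp: nth_append unmark_def)
      next
        case 3
        then show ?thesis using ui i by (auto simp: nth_append unmark_def)
      qed
    qed
  qed
  show ?thesis
  proof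
    show "marked_at_one x (mark \<sigma> w) \<subseteq> (\<lambda>v. mark (\<sigma>(x := v)) w) ` {1..length w}"
    proof
      fix b assume "b \<in> marked_at_one x (mark \<sigma> w)"
      then obtain u a S v where b: "b = unmark x u @ (a, insert x S) # unmark x v"
        and e: "mark \<sigma> w = u @ (a, S) # v" unfolding marked_at_one_def by blast
      have "Suc (length u) \<in> {1..length w}"
        using arg_cong[OF e, of length] by simp
      then show "b \<in> (\<lambda>v. mark (\<sigma>(x := v)) w) ` {1..length w}"
        unfolding b *[OF e] by blast
    qed
    show "(\<lambda>v. mark (\<sigma>(x := v)) w) ` {1..length w} \<subseteq> marked_at_one x (mark \<sigma> w)"
    proof
      fix b assume "b \<in> (\<lambda>v. mark (\<sigma>(x := v)) w) ` {1..length w}"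
      then obtain v where v: "v \<in> {1..length w}" "b = mark (\<sigma>(x := v)) w" by blast
      define i where "i = v - 1"
      have i: "i < length w" "b = mark (\<sigma>(x := Suc i)) w" using v by (auto simp: i_def)
      have e: "mark \<sigma> w = take i (mark \<sigma> w) @ (w ! i, {x. \<sigma> x = Suc i}) # drop (Suc i) (mark \<sigma> w)"
        using id_take_nth_drop[of i "mark \<sigma> w"] i by simp
      have "b = unmark x (take i (mark \<sigma> w)) @ (w ! i, insert x {x. \<sigma> x = Suc i}) # unmark x (drop (Suc i) (mark \<sigma> w))"
        using *[OF e] i by simp
      then show "b \<in> marked_at_one x (mark \<sigma> w)"
        unfolding marked_at_one_def using e by blast
    qed
  qed
qed

lemma sat_iff_mark_in_lang:
  assumes "\<forall>x\<in>fv \<phi>. \<sigma> x \<in> {1..length w}"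
  shows "sat {1..length w} (\<lambda>v u. edge_of_word K w (min v u, max v u)) (\<le>) \<sigma> \<phi> \<longleftrightarrow> mark \<sigma> w \<in> lang K \<phi>"
  using assms
proof (induction \<phi> arbitrary: \<sigma>)
  case (Eq x y)
  obtain i j where "\<sigma> x = Suc i" "\<sigma> y = Suc j" "i < length w" "j < length w"
    using Eq.prems by (auto simp: Suc_le_eq gr0_conv_Suc)
  then show ?case by (auto simp: at_distance_def)
next
  case (Le x y)
  obtain i j where ij: "\<sigma> x = Suc i" "\<sigma> y = Suc j" "i < length w" "j < length w"
    using Le.prems by (auto simp: Suc_le_eq gr0_conv_Suc)
  have "mark \<sigma> w \<in> lang K (Le x y)" if "i \<le> j"
    unfolding lang.simps in_order_def mem_Collect_eq
    by (rule exI[of _ i], rule exI[of _ j]) (use that ij in auto)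
  moreover have "i \<le> j" if "mark \<sigma> w \<in> lang K (Le x y)"
    using that ij by (auto simp: in_order_def)
  ultimately show ?case using ij by auto
next
  case (Adj x y)
  obtain i j where ij: "\<sigma> x = Suc i" "\<sigma> y = Suc j" "i < length w" "j < length w"
    using Adj.prems by (auto simp: Suc_le_eq gr0_conv_Suc)
  have hit: "mark \<sigma> w \<in> at_distance d (\<lambda>(a, S). x \<in> S) (\<lambda>(a, S). y \<in> S \<and> a d) \<longleftrightarrow> i + d = j \<and> (w ! j) d"
    if "\<sigma> x = Suc i" "\<sigma> y = Suc j" "i < length w" "j < length w" for d x y i j
    using that by (auto simp: at_distance_def intro!: exI[of _ i])
  have "mark \<sigma> w \<in> lang K (Adj x y) \<longleftrightarrow>
      (\<exists>d\<in>{1..K}. (i + d = j \<and> (w ! j) d) \<or> (j + d = i \<and> (w ! i) d))"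
    unfolding lang.simps UN_iff Un_iff by (simp only: hit[OF ij] hit[OF ij(2,1,4,3)])
  also have "\<dots> \<longleftrightarrow> edge_of_word K w (min (\<sigma> x) (\<sigma> y), max (\<sigma> x) (\<sigma> y))"
    using ij by (auto simp: edge_of_word_def min_def max_def Bex_def intro: exI[of _ "j - i"] exI[of _ "i - j"])
  finally show ?case by simp
next
  case (Ex x \<phi>)
  have "sat {1..length w} (\<lambda>v u. edge_of_word K w (min v u, max v u)) (\<le>) (\<sigma>(x := v)) \<phi> \<longleftrightarrow>
      mark (\<sigma>(x := v)) w \<in> lang K \<phi>" if "v \<in> {1..length w}" for v
    by (rule Ex.IH) (use that Ex.prems in auto)
  then show ?case by (simp add: marked_at_one_mark)
qed simp_all

lemma Pi_pmf_reindex: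
  assumes "finite A" "\<And>x. x \<in> A \<Longrightarrow> g (h x) = x"
  shows "Pi_pmf (h ` A) dflt P =
    map_pmf (\<lambda>X y. if y \<in> h ` A then X (g y) else dflt) (Pi_pmf A dflt (\<lambda>x. P (h x)))"
  using assms
proof (induction A rule: finite_induct)
  case (insert x A)
  have notin: "h x \<notin> h ` A" using insert.hyps insert.prems by (metis imageE insert_iff)
  have "Pi_pmf (h ` insert x A) dflt P =
      map_pmf (\<lambda>(b, Y). Y(h x := b)) (pair_pmf (P (h x)) (Pi_pmf (h ` A) dflt P))"
    using insert.hyps notin by (simp add: Pi_pmf_insert)
  also have "\<dots> = map_pmf (\<lambda>(b, X). (\<lambda>y. if y \<in> h ` A then X (g y) else dflt)(h x := b))
      (pair_pmf (P (h x)) (Pi_pmf A dflt (\<lambda>x. P (h x))))"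
    using insert by (simp add: pair_map_pmf2 pmf.map_comp o_def case_prod_unfold)
  also have "\<dots> = map_pmf (\<lambda>(b, X) y. if y \<in> h ` insert x A then (X(x := b)) (g y) else dflt)
      (pair_pmf (P (h x)) (Pi_pmf A dflt (\<lambda>x. P (h x))))"
    by (intro map_pmf_cong refl) (use insert.prems insert.hyps notin in \<open>auto simp: fun_eq_iff\<close>)
  also have "\<dots> = map_pmf (\<lambda>X y. if y \<in> h ` insert x A then X (g y) else dflt)
      (Pi_pmf (insert x A) dflt (\<lambda>x. P (h x)))"
    using insert.hyps by (simp add: Pi_pmf_insert pmf.map_comp o_def case_prod_unfold)
  finally show ?case .
qed simp

text \<open>
  By induction on the number of vertices: the edges from vertex \<open>n + 1\<close> back to earlier vertices are
  independent of everything before, and they are the meaningful bits of one new letter.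
\<close>

lemma Pi_pmf_edges_eq_word:
  fixes p :: "nat \<Rightarrow> real"
  assumes zero: "\<And>d. d > K \<Longrightarrow> p d = 0"
  shows "Pi_pmf (vertex_pairs n) False (\<lambda>(v, w). bernoulli_pmf (p (w - v))) =
    map_pmf (edge_of_word K) (replicate_pmf n (Pi_pmf {1..K} False (\<lambda>d. bernoulli_pmf (p d))))"
proof -
  define P where "P = (\<lambda>(v :: nat, w). bernoulli_pmf (p (w - v)))"
  define q where "q = Pi_pmf {1..K} False (\<lambda>d. bernoulli_pmf (p d))"
  define near where "near n = {(i, j). 1 \<le> i \<and> i < j \<and> j \<le> n \<and> j - i \<le> K}" for n :: nat
  define fresh where "fresh n = {(i, j). j = Suc n \<and> 1 \<le> i \<and> i \<le> n \<and> Suc n - i \<le> K}" for n :: nat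
  have fin: "finite (vertex_pairs n)" "finite (near n)" "finite (fresh n)" for n
    by (rule finite_subset[of _ "{..Suc n} \<times> {..Suc n}"]; force simp: vertex_pairs_def near_def fresh_def)+
  have "Pi_pmf (near n) False P = map_pmf (edge_of_word K) (replicate_pmf n q)"
  proof (induction n)
    case 0
    have "near 0 = {}" "edge_of_word K [] = (\<lambda>_. False)"
      by (auto simp: near_def edge_of_word_def fun_eq_iff)
    then show ?case by simp
  next
    case (Suc n)
    define g where "g = (\<lambda>(i :: nat, j :: nat). j - i)"
    let ?h = "\<lambda>d. (Suc n - d, Suc n)"
    have img: "fresh n = ?h ` {1..min n K}"
    proof (rule set_eqI, clarify)
      fix i j
      show "(i, j) \<in> fresh n \<longleftrightarrow> (i, j) \<in> ?h ` {1..min n K}"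
        by (auto simp: fresh_def image_iff intro!: bexI[of _ "Suc n - i"])
    qed
    have "Pi_pmf (fresh n) False P =
        map_pmf (\<lambda>X y. if y \<in> fresh n then X (g y) else False) (Pi_pmf {1..min n K} False (\<lambda>d. P (?h d)))"
      unfolding img by (rule Pi_pmf_reindex) (auto simp: g_def)
    also have "Pi_pmf {1..min n K} False (\<lambda>d. P (?h d)) = Pi_pmf {1..min n K} False (\<lambda>d. bernoulli_pmf (p d))"
      by (rule Pi_pmf_cong) (auto simp: P_def)
    also have "\<dots> = map_pmf (\<lambda>X d. if d \<in> {1..min n K} then X d else False) q"
      unfolding q_def by (rule Pi_pmf_subset) auto
    also have "map_pmf (\<lambda>X y. if y \<in> fresh n then X (g y) else False) \<dots> =
        map_pmf (\<lambda>a y. y \<in> fresh n \<and> a (g y)) q"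
      unfolding pmf.map_comp by (intro map_pmf_cong refl) (auto simp: fun_eq_iff fresh_def g_def)
    finally have fresh: "Pi_pmf (fresh n) False P = map_pmf (\<lambda>a y. y \<in> fresh n \<and> a (g y)) q" .
    have split: "near (Suc n) = near n \<union> fresh n" "near n \<inter> fresh n = {}"
      by (auto simp: near_def fresh_def)
    have "Pi_pmf (near (Suc n)) False P =
        map_pmf (\<lambda>(X, Y) e. if e \<in> near n then X e else Y e) (pair_pmf (Pi_pmf (near n) False P) (Pi_pmf (fresh n) False P))"
      unfolding split(1) by (rule Pi_pmf_union) (use fin split in auto)
    also have "\<dots> = map_pmf (\<lambda>(w, a) e. if e \<in> near n then edge_of_word K w e else e \<in> fresh n \<and> a (g e))
        (pair_pmf (replicate_pmf n q) q)"
      unfolding Suc.IH fresh by (simp add: pair_map_pmf1 pair_map_pmf2 pmf.map_comp o_def case_prod_unfold)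
    also have "\<dots> = map_pmf (\<lambda>(w, a). edge_of_word K (w @ [a])) (pair_pmf (replicate_pmf n q) q)"
      by (intro map_pmf_cong refl)
        (auto simp: fun_eq_iff set_replicate_pmf edge_of_word_def near_def fresh_def g_def nth_append less_Suc_eq_le)
    also have "\<dots> = map_pmf (edge_of_word K) (replicate_pmf (Suc n) q)"
      unfolding Suc_eq_plus1 replicate_pmf_add replicate_pmf_1
      by (simp add: pair_map_pmf2 pmf.map_comp o_def case_prod_unfold)
    finally show ?case .
  qed
  moreover have b0: "bernoulli_pmf 0 = return_pmf False"
  proof (rule pmf_eqI)
    show "pmf (bernoulli_pmf 0) b = pmf (return_pmf False) b" for b by (cases b) simp_all
  qed
  have "Pi_pmf (vertex_pairs n) False P = Pi_pmf (near n) False P"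
  proof (rule Pi_pmf_subset')
    fix e assume "e \<in> vertex_pairs n - near n"
    moreover obtain v w where e: "e = (v, w)" by (cases e)
    ultimately have "w - v > K" by (auto simp: vertex_pairs_def near_def)
    with e show "P e = return_pmf False" using zero b0 by (simp add: P_def)
  qed (use fin in \<open>auto simp: near_def vertex_pairs_def\<close>)
  ultimately show ?thesis by (simp add: P_def q_def)
qed

theorem convergent_Prob_finite_support:
  assumes "finite {i. i \<ge> 1 \<and> p i \<noteq> 0}" "sentence \<psi>"
  shows "convergent (\<lambda>n. Prob n p \<psi>)"
proof -
  \<comment> \<open>The inserted 0 covers the case that all probabilities vanish.\<close>
  define K where "K = Max (insert 0 {i. i \<ge> 1 \<and> p i \<noteq> 0})"
  have zero: "p d = 0" if "d > K" for d
  proof (rule ccontr)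
    assume "p d \<noteq> 0"
    then have "d \<le> K" unfolding K_def using assms(1) that by (intro Max_ge) auto
    with that show False by simp
  qed
  define q where "q = Pi_pmf {1..K} False (\<lambda>d. bernoulli_pmf (p d))"
  define L where "L = {w. map (\<lambda>a. (a, {})) w \<in> lang K \<psi>}"
  have "Prob n p \<psi> = measure_pmf.prob (replicate_pmf n q) L" for n
  proof -
    have word: "Pi_pmf (vertex_pairs n) False (\<lambda>(v, w). bernoulli_pmf (p (w - v))) =
        map_pmf (edge_of_word K) (replicate_pmf n q)"
      unfolding q_def by (rule Pi_pmf_edges_eq_word) (rule zero)
    have "Prob n p \<psi> = measure_pmf.prob (replicate_pmf n q)
        {w. sat {1..n} (\<lambda>v u. edge_of_word K w (min v u, max v u)) (\<le>) (\<lambda>_. 0) \<psi>}"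
      by (simp add: Prob_def random_graph_def word vimage_def)
    also have "\<dots> = measure_pmf.prob (replicate_pmf n q) L"
    proof (rule measure_pmf.finite_measure_eq_AE)
      have "sat {1..length w} (\<lambda>v u. edge_of_word K w (min v u, max v u)) (\<le>) (\<lambda>_. 0) \<psi> \<longleftrightarrow> w \<in> L" for w
      proof -
        have "mark (\<lambda>_. 0) w = map (\<lambda>a. (a, {})) w"
          by (rule nth_equalityI) simp_all
        then show ?thesis
          using sat_iff_mark_in_lang[of \<psi> "\<lambda>_. 0" w K] assms(2) by (simp add: sentence_def L_def)
      qed
      then show "AE w in replicate_pmf n q.
          w \<in> {w. sat {1..n} (\<lambda>v u. edge_of_word K w (min v u, max v u)) (\<le>) (\<lambda>_. 0) \<psi>} \<longleftrightarrow> w \<in> L"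
        by (auto simp: AE_measure_pmf_iff set_replicate_pmf)
    qed simp_all
    finally show ?thesis .
  qed
  then show ?thesis
    using convergent_prob_aperiodic[OF aperiodic_vimage_map[OF aperiodic_lang]] by (simp add: L_def)
qed

section \<open>Independent groups of edges\<close>

lemma prob_Pi_pmf_indep:
  assumes fin: "finite A" "finite B" and disj: "A \<inter> B = {}"
    and Q: "\<And>X Y. (\<And>e. e \<in> A \<Longrightarrow> X e = Y e) \<Longrightarrow> Q X \<longleftrightarrow> Q Y"
    and R: "\<And>X Y. (\<And>e. e \<in> B \<Longrightarrow> X e = Y e) \<Longrightarrow> R X \<longleftrightarrow> R Y"
  shows "measure_pmf.prob (Pi_pmf (A \<union> B) dflt P) {X. Q X \<and> R X} =
    measure_pmf.prob (Pi_pmf A dflt P) {X. Q X} * measure_pmf.prob (Pi_pmf B dflt P) {X. R X}"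
proof -
  let ?m = "\<lambda>(X, Y) e. if e \<in> A then X e else Y e"
  have "Q (?m (X, Y)) \<longleftrightarrow> Q X" "R (?m (X, Y)) \<longleftrightarrow> R Y" for X Y
    using disj by (auto intro!: Q R)
  then have "?m -` {X. Q X \<and> R X} = {X. Q X} \<times> {X. R X}" by auto
  then have "measure_pmf.prob (Pi_pmf (A \<union> B) dflt P) {X. Q X \<and> R X} =
      measure_pmf.prob (pair_pmf (Pi_pmf A dflt P) (Pi_pmf B dflt P)) ({X. Q X} \<times> {X. R X})"
    by (simp add: Pi_pmf_union[OF fin disj])
  also have "\<dots> = measure_pmf.prob (Pi_pmf A dflt P) {X. Q X} * measure_pmf.prob (Pi_pmf B dflt P) {X. R X}"
    by (rule prob_pair_pmf_Times)
  finally show ?thesis .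
qed

lemma prob_no_group_complete:
  fixes p :: "'e \<Rightarrow> real"
  assumes "finite E" "finite U" and disj: "disjoint_family_on S U"
    and sub: "\<And>u. u \<in> U \<Longrightarrow> S u \<subseteq> E" and p: "\<And>e. e \<in> E \<Longrightarrow> 0 \<le> p e \<and> p e \<le> 1"
  shows "measure_pmf.prob (Pi_pmf E False (\<lambda>e. bernoulli_pmf (p e))) {X. \<forall>u\<in>U. \<exists>e\<in>S u. \<not> X e} =
    (\<Prod>u\<in>U. 1 - (\<Prod>e\<in>S u. p e))"
proof -
  define P where "P = (\<lambda>e. bernoulli_pmf (p e))"
  have "measure_pmf.prob (Pi_pmf (\<Union>u\<in>U. S u) False P) {X. \<forall>u\<in>U. \<exists>e\<in>S u. \<not> X e} =
      (\<Prod>u\<in>U. 1 - (\<Prod>e\<in>S u. p e))"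
    using \<open>finite U\<close> disj sub
  proof (induction U rule: finite_induct)
    case (insert u U)
    have finS: "finite (S v)" if "v \<in> insert u U" for v
      using insert.prems(2)[OF that] \<open>finite E\<close> by (rule finite_subset)
    have "S u \<inter> (\<Union>v\<in>U. S v) = {}"
      using insert.prems(1) insert.hyps(2) unfolding disjoint_family_on_def by fastforce
    have one: "measure_pmf.prob (Pi_pmf (S u) False P) {X. \<exists>e\<in>S u. \<not> X e} = 1 - (\<Prod>e\<in>S u. p e)"
    proof -
      have "measure_pmf.prob (Pi_pmf (S u) False P) (Pi (S u) (\<lambda>_. {True})) = (\<Prod>e\<in>S u. p e)"
        unfolding measure_Pi_pmf_Pi[OF finS[OF insertI1]]
        using p insert.prems(2)[of u] by (intro prod.cong) (auto simp: P_def measure_pmf_single)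
      moreover have "{X. \<exists>e\<in>S u. \<not> X e} = UNIV - Pi (S u) (\<lambda>_. {True})"
        by (auto simp: Pi_def)
      ultimately show ?thesis
        using measure_pmf.prob_compl[of "Pi (S u) (\<lambda>_. {True})" "Pi_pmf (S u) False P"] by simp
    qed
    have "measure_pmf.prob (Pi_pmf (S u \<union> (\<Union>v\<in>U. S v)) False P)
          {X. (\<exists>e\<in>S u. \<not> X e) \<and> (\<forall>v\<in>U. \<exists>e\<in>S v. \<not> X e)} =
        measure_pmf.prob (Pi_pmf (S u) False P) {X. \<exists>e\<in>S u. \<not> X e} *
        measure_pmf.prob (Pi_pmf (\<Union>v\<in>U. S v) False P) {X. \<forall>v\<in>U. \<exists>e\<in>S v. \<not> X e}"
    proof (rule prob_Pi_pmf_indep)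
      show "(\<forall>v\<in>U. \<exists>e\<in>S v. \<not> X e) \<longleftrightarrow> (\<forall>v\<in>U. \<exists>e\<in>S v. \<not> Y e)"
        if "\<And>e. e \<in> (\<Union>v\<in>U. S v) \<Longrightarrow> X e = Y e" for X Y
        by (intro ball_cong bex_cong refl) (use that in auto)
    qed (use finS insert.hyps \<open>S u \<inter> _ = {}\<close> in auto)
    also have "\<dots> = (1 - (\<Prod>e\<in>S u. p e)) * (\<Prod>u\<in>U. 1 - (\<Prod>e\<in>S u. p e))"
    proof -
      have "disjoint_family_on S U"
        using insert.prems(1) by (rule disjoint_family_on_mono[rotated]) auto
      then show ?thesis using one insert.IH insert.prems(2) by simp
    qed
    finally show ?case using insert.hyps by (simp add: Un_commute)
  qed simp
  moreover have "measure_pmf.prob (Pi_pmf ((\<Union>u\<in>U. S u) \<union> (E - (\<Union>u\<in>U. S u))) False P)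
        {X. (\<forall>u\<in>U. \<exists>e\<in>S u. \<not> X e) \<and> True} =
      measure_pmf.prob (Pi_pmf (\<Union>u\<in>U. S u) False P) {X. \<forall>u\<in>U. \<exists>e\<in>S u. \<not> X e} *
      measure_pmf.prob (Pi_pmf (E - (\<Union>u\<in>U. S u)) False P) {X. True}"
  proof (rule prob_Pi_pmf_indep)
    show "(\<forall>u\<in>U. \<exists>e\<in>S u. \<not> X e) \<longleftrightarrow> (\<forall>u\<in>U. \<exists>e\<in>S u. \<not> Y e)"
      if "\<And>e. e \<in> (\<Union>u\<in>U. S u) \<Longrightarrow> X e = Y e" for X Y
      by (intro ball_cong bex_cong refl) (use that in auto)
    show "finite (\<Union>u\<in>U. S u)" by (rule finite_subset[OF _ \<open>finite E\<close>]) (use sub in blast)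
  qed (use \<open>finite E\<close> in auto)
  moreover have "(\<Union>u\<in>U. S u) \<union> (E - (\<Union>u\<in>U. S u)) = E" using sub by blast
  ultimately show ?thesis by (simp add: P_def)
qed

section \<open>Scales\<close>

text \<open>
  Edge lengths that come in pairs \<open>d, 2 * d\<close>, with a factor of at least 4 between consecutive pairs. The
  only additive relations among them are \<open>d + d = 2 * d\<close>, so a triangle of such edges reveals that its
  two short sides are equal, and of odd level.
\<close>

locale scales =
  fixes f :: "nat \<Rightarrow> nat"
  assumes f_pos1: "f 1 \<ge> 1"
    and f_even: "s \<ge> 1 \<Longrightarrow> f (2 * s) = 2 * f (2 * s - 1)"
    and f_odd: "s \<ge> 1 \<Longrightarrow> f (2 * s + 1) \<ge> 4 * f (2 * s)"
begin

lemma f_Suc: "i \<ge> 1 \<Longrightarrow> 2 * f i \<le> f (Suc i)"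
proof (cases "even i")
  case True
  assume "i \<ge> 1"
  with True obtain s where "i = 2 * s" "s \<ge> 1" by (auto elim!: evenE)
  then show ?thesis using f_odd[of s] by simp
next
  case False
  then obtain s where "i = 2 * s + 1" by (auto elim!: oddE)
  then show ?thesis using f_even[of "Suc s"] by simp
qed

lemma f_pos: "i \<ge> 1 \<Longrightarrow> f i > 0"
proof (induction i rule: dec_induct)
  case base
  then show ?case using f_pos1 by simp
next
  case (step i)
  then show ?case using f_Suc[of i] by simp
qed

lemma f_less: "1 \<le> i \<Longrightarrow> i < j \<Longrightarrow> f i < f j"
proof (induction j)
  case (Suc j)
  have "f j < f (Suc j)" using f_Suc[of j] f_pos[of j] Suc.prems by simp
  then show ?case using Suc by (cases "i = j") auto
qed simp

lemma f_le: "1 \<le> i \<Longrightarrow> i \<le> j \<Longrightarrow> f i \<le> f j"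
  using f_less[of i j] by (cases "i = j") auto

lemma f_less_iff: "1 \<le> i \<Longrightarrow> 1 \<le> j \<Longrightarrow> f i < f j \<longleftrightarrow> i < j"
  using f_less[of i j] f_le[of j i] by (meson linorder_not_less)

lemma f_inj: "1 \<le> i \<Longrightarrow> 1 \<le> j \<Longrightarrow> f i = f j \<Longrightarrow> i = j"
  using f_less_iff[of i j] f_less_iff[of j i] by auto

lemma f_add_eq:
  assumes "i \<ge> 1" "j \<ge> 1" "k \<ge> 1" "f i + f j = f k"
  shows "odd i \<and> j = i \<and> k = i + 1"
proof -
  have lt: "i < k" "j < k"
    using assms f_pos[of i] f_pos[of j] f_less_iff[of i k] f_less_iff[of j k] by simp_all
  show ?thesis
  proof (cases "even k")
    case True
    then obtain s where s: "k = 2 * s" "s \<ge> 1" using assms(3) by (auto elim!: evenE)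
    have "f i \<le> f (2 * s - 1)" "f j \<le> f (2 * s - 1)" using lt s assms by (auto intro!: f_le)
    then have "f i = f (2 * s - 1)" "f j = f (2 * s - 1)" using assms(4) f_even[of s] s by simp_all
    then have "i = 2 * s - 1" "j = 2 * s - 1" using s assms by (auto intro!: f_inj)
    then show ?thesis using s by simp
  next
    case False
    then obtain s where s: "k = 2 * s + 1" by (auto elim!: oddE)
    then have "s \<ge> 1" using lt assms by simp
    have "f i \<le> f (2 * s)" "f j \<le> f (2 * s)" using lt s assms by (auto intro!: f_le)
    then have "f k < 4 * f (2 * s)" using assms(4) f_pos[of "2 * s"] \<open>s \<ge> 1\<close> by simp
    then show ?thesis using f_odd[OF \<open>s \<ge> 1\<close>] s by simp
  qed
qed

text \<open>
  Every point \<open>z\<close> of the left half of \<open>{1..f t + f (t - 2)}\<close> that is not too small for the scale \<open>2 * s\<close>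
  has a level \<open>l\<close> such that all edges of level \<open>l + 2\<close> starting in \<open>{1..f l}\<close> start at or before \<open>z\<close> and
  end beyond \<open>z + f (2 * s)\<close>. Usually \<open>l\<close> is the largest level with \<open>f l \<le> z\<close>. If that exceeds \<open>t - 2\<close>,
  the top level \<open>t\<close> itself does it, and it is here that \<open>z\<close> must lie in the left half.
\<close>

lemma level_between:
  assumes "odd t" "s \<ge> 1" "2 * s < t" "f (2 * s - 1) \<le> z" "2 * z \<le> f t + f (t - 2)"
  obtains l where "1 \<le> l" "l \<le> t - 2" "f l \<le> z" "z + f (2 * s) < f (l + 2)"
proof -
  obtain r where r: "t = 2 * r + 1" using assms(1) by (auto elim!: oddE)
  then have "r \<ge> 1" using assms by simp
  show thesis
  proof (cases "f (t - 1) \<le> z")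
    case True
    have "4 * f (t - 1) \<le> f t" using f_odd[OF \<open>r \<ge> 1\<close>] r by simp
    moreover have "f (t - 2) < f (t - 1)" using r \<open>r \<ge> 1\<close> by (intro f_less) auto
    moreover have "f (2 * s) \<le> f (t - 1)" using assms by (intro f_le) auto
    ultimately have "z + f (2 * s) < f t" using assms(5) by linarith
    moreover have "t - 2 + 2 = t" using r \<open>r \<ge> 1\<close> by simp
    ultimately show thesis
      using True \<open>f (t - 2) < f (t - 1)\<close> r \<open>r \<ge> 1\<close> by (intro that[of "t - 2"]) auto
  next
    case False
    define m where "m = (LEAST m. m \<ge> 1 \<and> z < f m)"
    have ex: "t - 1 \<ge> 1 \<and> z < f (t - 1)" using False r \<open>r \<ge> 1\<close> by simp
    have m: "m \<ge> 1" "z < f m"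
      using LeastI[of "\<lambda>m. m \<ge> 1 \<and> z < f m", OF ex] by (simp_all add: m_def)
    have "m \<le> t - 1" unfolding m_def using ex by (rule Least_le)
    have "m > 2 * s - 1"
    proof (rule ccontr)
      assume "\<not> m > 2 * s - 1"
      then have "f m \<le> f (2 * s - 1)" using m by (intro f_le) auto
      then show False using m assms(4) by simp
    qed
    then have "2 * s \<le> m" "m - 1 \<ge> 1" using assms(2) by linarith+
    have "f (m - 1) \<le> z"
    proof (rule ccontr)
      assume "\<not> f (m - 1) \<le> z"
      then have "m \<le> m - 1" using \<open>m - 1 \<ge> 1\<close> unfolding m_def by (intro Least_le) auto
      then show False using m by simp
    qed
    moreover have "f (2 * s) \<le> f m" using \<open>2 * s \<le> m\<close> assms by (intro f_le) auto
    then have "z + f (2 * s) < f (Suc m)" using m f_Suc[of m] by linarith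
    then have "z + f (2 * s) < f (m - 1 + 2)" using m by simp
    ultimately show thesis using \<open>m \<le> t - 1\<close> \<open>m - 1 \<ge> 1\<close> by (intro that[of "m - 1"]) auto
  qed
qed

end

text \<open>
  A pair of levels has only one free length, so it must satisfy the requirements of both.
\<close>

lemma ex_scales:
  fixes R :: "nat \<Rightarrow> nat"
  obtains f where "scales f" "\<And>i. i \<ge> 1 \<Longrightarrow> R i \<le> f i"
proof -
  define h where "h = rec_nat (R 1 + R 2 + 1) (\<lambda>s x. 8 * x + R (2 * s + 3) + R (2 * s + 4))"
  have h0: "h 0 = R 1 + R 2 + 1" and hS: "h (Suc s) = 8 * h s + R (2 * s + 3) + R (2 * s + 4)" for s
    by (simp_all add: h_def)
  define f where "f i = (if odd i then h (i div 2) else 2 * h (i div 2 - 1))" for i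
  have hR: "R (2 * s + 1) \<le> h s" "R (2 * s + 2) \<le> h s" for s
    by (cases s; simp add: h0 hS numeral_eq_Suc)+
  show thesis
  proof (rule that[of f])
    show "scales f"
    proof
      show "1 \<le> f 1" by (simp add: f_def h0)
      fix s :: nat assume "s \<ge> 1"
      then obtain r where "s = Suc r" by (cases s) auto
      then show "f (2 * s) = 2 * f (2 * s - 1)" "4 * f (2 * s) \<le> f (2 * s + 1)"
        by (simp_all add: f_def hS)
    qed
    show "R i \<le> f i" if "i \<ge> 1" for i
    proof (cases "odd i")
      case True
      then obtain s where "i = 2 * s + 1" by (auto elim!: oddE)
      then show ?thesis using hR(1)[of s] by (simp add: f_def)
    next
      case False
      then obtain s where "i = 2 * s" by (auto elim!: evenE)
      with that obtain r where "i = 2 * Suc r" by (cases s) auto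
      then show ?thesis using hR(2)[of r] by (simp add: f_def)
    qed
  qed
qed

section \<open>The ladder sentence\<close>

text \<open>
  Four vertices joined as two overlapping triangles. For edge lengths as above this makes them equally
  spaced with a spacing \<open>d = f (2 * s - 1)\<close>. The ladder is crossed by an edge from the left part \<open>{..v1}\<close>
  over the end \<open>v3\<close>, a distance of more than \<open>2 * d = f (2 * s)\<close>, or symmetrically by one from left of
  \<open>v0\<close> to the right part \<open>{v2..}\<close>. So every crossing edge has a higher level than the ladder.
\<close>

definition uncrossed_ladder :: "nat \<Rightarrow> (nat \<Rightarrow> nat \<Rightarrow> bool) \<Rightarrow> nat \<Rightarrow> nat \<Rightarrow> nat \<Rightarrow> nat \<Rightarrow> bool" where
  "uncrossed_ladder n E v0 v1 v2 v3 \<longleftrightarrow>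
     v0 < v1 \<and> v1 < v2 \<and> v2 < v3 \<and>
     E v0 v1 \<and> E v1 v2 \<and> E v2 v3 \<and> E v0 v2 \<and> E v1 v3 \<and>
     \<not> (\<exists>x\<in>{1..n}. \<exists>z\<in>{1..n}. x \<le> v1 \<and> v3 < z \<and> E x z) \<and>
     \<not> (\<exists>x\<in>{1..n}. \<exists>z\<in>{1..n}. x < v0 \<and> v2 \<le> z \<and> E x z)"

definition Lt :: "nat \<Rightarrow> nat \<Rightarrow> fm" where
  "Lt x y = Conj (Le x y) (Neg (Eq x y))"

definition ladder_sentence :: fm where
  "ladder_sentence = Ex 0 (Ex 1 (Ex 2 (Ex 3
     (Conj (Lt 0 1) (Conj (Lt 1 2) (Conj (Lt 2 3)
     (Conj (Adj 0 1) (Conj (Adj 1 2) (Conj (Adj 2 3) (Conj (Adj 0 2) (Conj (Adj 1 3)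
     (Conj (Neg (Ex 4 (Ex 5 (Conj (Le 4 1) (Conj (Lt 3 5) (Adj 4 5))))))
           (Neg (Ex 4 (Ex 5 (Conj (Lt 4 0) (Conj (Le 2 5) (Adj 4 5))))))))))))))))))"

lemma sentence_ladder: "sentence ladder_sentence"
  by (auto simp: sentence_def ladder_sentence_def Lt_def)

lemma sat_ladder_sentence:
  "sat {1..n} E (\<le>) \<sigma> ladder_sentence \<longleftrightarrow>
    (\<exists>v0\<in>{1..n}. \<exists>v1\<in>{1..n}. \<exists>v2\<in>{1..n}. \<exists>v3\<in>{1..n}. uncrossed_ladder n E v0 v1 v2 v3)"
  by (simp add: ladder_sentence_def Lt_def uncrossed_ladder_def less_le conj_assoc)


section \<open>Probability of an uncrossed ladder\<close>

definition edge_law :: "nat \<Rightarrow> (nat \<Rightarrow> real) \<Rightarrow> (nat \<times> nat \<Rightarrow> bool) pmf" where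
  "edge_law n p = Pi_pmf (vertex_pairs n) False (\<lambda>e. bernoulli_pmf (p (snd e - fst e)))"

definition has_uncrossed_ladder :: "nat \<Rightarrow> (nat \<times> nat \<Rightarrow> bool) \<Rightarrow> bool" where
  "has_uncrossed_ladder n X \<longleftrightarrow> (\<exists>v0\<in>{1..n}. \<exists>v1\<in>{1..n}. \<exists>v2\<in>{1..n}. \<exists>v3\<in>{1..n}.
     uncrossed_ladder n (\<lambda>v w. X (min v w, max v w)) v0 v1 v2 v3)"

lemma Prob_ladder_sentence:
  "Prob n p ladder_sentence = measure_pmf.prob (edge_law n p) {X. has_uncrossed_ladder n X}"
  unfolding Prob_def random_graph_def edge_law_def sat_ladder_sentence
  by (simp add: vimage_def has_uncrossed_ladder_def case_prod_unfold)

lemma finite_vertex_pairs: "finite (vertex_pairs n)"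
  by (rule finite_subset[of _ "{..n} \<times> {..n}"]) (auto simp: vertex_pairs_def)

locale spread_sequence = scales +
  fixes a p :: "nat \<Rightarrow> real"
  assumes a_range: "i \<ge> 1 \<Longrightarrow> 0 < a i \<and> a i \<le> 1"
    and p_scale: "i \<ge> 1 \<Longrightarrow> p (f i) = a i"
    and p_gap: "j \<ge> 1 \<Longrightarrow> j \<notin> f ` {1..} \<Longrightarrow> p j = 0"
begin

lemma p_range: "j \<ge> 1 \<Longrightarrow> 0 \<le> p j \<and> p j \<le> 1"
  using p_scale p_gap[of j] a_range by (cases "j \<in> f ` {1..}") (auto simp: less_imp_le)

lemma p_pair: "e \<in> vertex_pairs n \<Longrightarrow> 0 \<le> p (snd e - fst e) \<and> p (snd e - fst e) \<le> 1"
  by (rule p_range) (auto simp: vertex_pairs_def)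

lemma edge_length:
  assumes "X \<in> set_pmf (edge_law n p)" "X (v, w)"
  shows "1 \<le> v \<and> v < w \<and> w \<le> n" "\<exists>i\<ge>1. w - v = f i"
proof -
  have "X \<in> PiE_dflt (vertex_pairs n) False (\<lambda>e. set_pmf (bernoulli_pmf (p (snd e - fst e))))"
    using assms(1) by (simp add: edge_law_def set_Pi_pmf[OF finite_vertex_pairs] o_def)
  then have X: "if (v, w) \<in> vertex_pairs n then X (v, w) \<in> set_pmf (bernoulli_pmf (p (w - v))) else \<not> X (v, w)"
    unfolding PiE_dflt_def by (metis (mono_tags, lifting) fst_conv mem_Collect_eq snd_conv)
  show vw: "1 \<le> v \<and> v < w \<and> w \<le> n" using X assms(2) by (simp add: vertex_pairs_def split: if_splits)
  have "True \<in> set_pmf (bernoulli_pmf (p (w - v)))" using X assms(2) by (simp split: if_splits)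
  then have "p (w - v) \<noteq> 0" by (auto simp: set_pmf_iff)
  moreover have "w - v \<ge> 1" using vw by linarith
  ultimately have "w - v \<in> f ` {1..}" using p_gap[of "w - v"] by blast
  then show "\<exists>i\<ge>1. w - v = f i" by auto
qed

lemma ladder_equally_spaced:
  assumes X: "X \<in> set_pmf (edge_law n p)"
    and lad: "uncrossed_ladder n (\<lambda>v w. X (min v w, max v w)) v0 v1 v2 v3"
  obtains s where "s \<ge> 1" "v1 = v0 + f (2 * s - 1)" "v2 = v1 + f (2 * s - 1)" "v3 = v2 + f (2 * s - 1)"
proof -
  have lt: "v0 < v1" "v1 < v2" "v2 < v3"
    and e: "X (v0, v1)" "X (v1, v2)" "X (v2, v3)" "X (v0, v2)" "X (v1, v3)"
    using lad by (auto simp: uncrossed_ladder_def min_def max_def split: if_splits)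
  obtain i where i: "i \<ge> 1" "v1 - v0 = f i" using edge_length(2)[OF X e(1)] by blast
  obtain j where j: "j \<ge> 1" "v2 - v1 = f j" using edge_length(2)[OF X e(2)] by blast
  obtain k where k: "k \<ge> 1" "v3 - v2 = f k" using edge_length(2)[OF X e(3)] by blast
  obtain l where l: "l \<ge> 1" "v2 - v0 = f l" using edge_length(2)[OF X e(4)] by blast
  obtain m where m: "m \<ge> 1" "v3 - v1 = f m" using edge_length(2)[OF X e(5)] by blast
  have "f i + f j = f l" "f j + f k = f m" using lt i j k l m by linarith+
  then have "odd i" "j = i" "k = j"
    using f_add_eq[of i j l] f_add_eq[of j k m] i(1) j(1) k(1) l(1) m(1) by simp_all
  then obtain r where "i = 2 * r + 1" by (auto elim!: oddE)
  then have "i = 2 * Suc r - 1" by simp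
  then show thesis
    using i j k lt \<open>j = i\<close> \<open>k = j\<close> by (intro that[of "Suc r"]) auto
qed

text \<open>
  On \<open>4 * d\<close> vertices, where \<open>d = f (2 * s - 1)\<close>, all edges have length at most \<open>2 * d\<close> because the next
  level is too long, and so nothing can cross a ladder of spacing \<open>d\<close>. The ladders starting at
  \<open>1, \<dots>, d\<close> use disjoint sets of edges, three of length \<open>d\<close> and two of length \<open>2 * d\<close>.
\<close>

lemma Prob_ladder_lower:
  assumes s: "s \<ge> 1"
  shows "1 - (1 - a (2 * s - 1) ^ 3 * a (2 * s) ^ 2) ^ f (2 * s - 1) \<le> Prob (4 * f (2 * s - 1)) p ladder_sentence"
proof -
  define d where "d = f (2 * s - 1)"
  define S where "S u = {(u, u + d), (u + d, u + 2 * d), (u + 2 * d, u + 3 * d), (u, u + 2 * d), (u + d, u + 3 * d)}" for u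
  define L where "L = edge_law (4 * d) p"
  have "2 * s - 1 \<ge> 1" using s by linarith
  then have d: "d \<ge> 1" using f_pos[of "2 * s - 1"] by (simp add: d_def)
  have d2: "2 * d = f (2 * s)" using f_even[OF s] by (simp add: d_def)
  have "measure_pmf.prob L {X. \<forall>u\<in>{1..d}. \<exists>e\<in>S u. \<not> X e} = (\<Prod>u\<in>{1..d}. 1 - (\<Prod>e\<in>S u. p (snd e - fst e)))"
    unfolding L_def edge_law_def
  proof (rule prob_no_group_complete)
    show "disjoint_family_on S {1..d}"
      by (auto simp: disjoint_family_on_def S_def)
    show "S u \<subseteq> vertex_pairs (4 * d)" if "u \<in> {1..d}" for u
      using that d by (auto simp: S_def vertex_pairs_def)
  qed (simp_all add: finite_vertex_pairs p_pair)
  also have "\<dots> = (1 - a (2 * s - 1) ^ 3 * a (2 * s) ^ 2) ^ d"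
  proof -
    have "p d = a (2 * s - 1)" "p (2 * d) = a (2 * s)"
      using p_scale[of "2 * s - 1"] p_scale[of "2 * s"] \<open>2 * s - 1 \<ge> 1\<close> s
      unfolding d2 by (simp_all add: d_def)
    then have "(\<Prod>e\<in>S u. p (snd e - fst e)) = a (2 * s - 1) ^ 3 * a (2 * s) ^ 2" for u
      using d by (simp add: S_def power3_eq_cube power2_eq_square)
    then show ?thesis by simp
  qed
  finally have fail: "measure_pmf.prob L {X. \<forall>u\<in>{1..d}. \<exists>e\<in>S u. \<not> X e} = (1 - a (2 * s - 1) ^ 3 * a (2 * s) ^ 2) ^ d" .
  have "has_uncrossed_ladder (4 * d) X" if X: "X \<in> set_pmf L" and u: "u \<in> {1..d}" "\<And>e. e \<in> S u \<Longrightarrow> X e" for X u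
  proof -
    have short: "w - v \<le> 2 * d" if edge: "X (v, w)" for v w
    proof -
      obtain i where i: "i \<ge> 1" "w - v = f i" and vw: "1 \<le> v" "w \<le> 4 * d"
        using edge_length[OF X[unfolded L_def] edge] by blast
      have "i \<le> 2 * s"
      proof (rule ccontr)
        assume "\<not> i \<le> 2 * s"
        then have "f (2 * s + 1) \<le> f i" by (intro f_le) auto
        then show False using f_odd[OF s] i vw d d2 by linarith
      qed
      then show ?thesis using f_le[of i "2 * s"] i d2 by simp
    qed
    have "uncrossed_ladder (4 * d) (\<lambda>v w. X (min v w, max v w)) u (u + d) (u + 2 * d) (u + 3 * d)"
      unfolding uncrossed_ladder_def
    proof (intro conjI)
      show "\<not> (\<exists>x\<in>{1..4 * d}. \<exists>z\<in>{1..4 * d}. x \<le> u + d \<and> u + 3 * d < z \<and> X (min x z, max x z))"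
        using short by (fastforce simp: min_def max_def)
      show "\<not> (\<exists>x\<in>{1..4 * d}. \<exists>z\<in>{1..4 * d}. x < u \<and> u + 2 * d \<le> z \<and> X (min x z, max x z))"
        using short by (fastforce simp: min_def max_def)
    qed (use u d in \<open>auto simp: S_def min_def max_def\<close>)
    moreover have "u \<in> {1..4 * d}" "u + d \<in> {1..4 * d}" "u + 2 * d \<in> {1..4 * d}" "u + 3 * d \<in> {1..4 * d}"
      using u d by auto
    ultimately show ?thesis unfolding has_uncrossed_ladder_def by blast
  qed
  then have "measure_pmf.prob L UNIV \<le> measure_pmf.prob L {X. has_uncrossed_ladder (4 * d) X} +
      measure_pmf.prob L {X. \<forall>u\<in>{1..d}. \<exists>e\<in>S u. \<not> X e}"
    by (intro prob_le_sum) blast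
  then show ?thesis unfolding Prob_ladder_sentence fail by (simp add: L_def d_def)
qed

text \<open>
  An odd top level \<open>t\<close> with few vertices beyond \<open>f t\<close>: level \<open>t + 1\<close> does not fit, so ladders have
  level below \<open>t\<close>. Suppose that for every \<open>l \<le> t - 2\<close> some edge of level \<open>l + 2\<close> starts in the first
  \<open>f l\<close> vertices and, symmetrically, some edge of that level ends in the last \<open>f l\<close> vertices. Then one
  of these edges crosses any given ladder: one from the first family if the ladder has \<open>v1\<close> in the left
  half, and one from the second family otherwise. The events \<open>left l\<close> and \<open>right l\<close> are the failures
  of the assumption.
\<close>

lemma Prob_ladder_upper:
  assumes t: "odd t" "t \<ge> 3"
  shows "Prob (f t + f (t - 2)) p ladder_sentence \<le> (\<Sum>l\<in>{1..t - 2}. 2 * (1 - a (l + 2)) ^ f l)"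
proof -
  define n where "n = f t + f (t - 2)"
  define L where "L = edge_law n p"
  define left where "left l = {X. \<forall>x\<in>{1..f l}. \<exists>e\<in>{(x, x + f (l + 2))}. \<not> X e}" for l
  define right where "right l = {X. \<forall>x\<in>{1..f l}. \<exists>e\<in>{(n + 1 - x - f (l + 2), n + 1 - x)}. \<not> X e}" for l
  have room: "f l + f (l + 2) \<le> n" "f (l + 2) > 0" "f l > 0" if "l \<in> {1..t - 2}" for l
  proof -
    have "f l \<le> f (t - 2)" "f (l + 2) \<le> f t" using that t by (auto intro!: f_le)
    then show "f l + f (l + 2) \<le> n" by (simp add: n_def)
  qed (use that in \<open>auto intro!: f_pos\<close>)
  have pl: "measure_pmf.prob L (left l) = (1 - a (l + 2)) ^ f l" if l: "l \<in> {1..t - 2}" for l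
  proof -
    have "measure_pmf.prob L (left l) = (\<Prod>x\<in>{1..f l}. 1 - (\<Prod>e\<in>{(x, x + f (l + 2))}. p (snd e - fst e)))"
      unfolding L_def edge_law_def left_def
    proof (rule prob_no_group_complete[OF finite_vertex_pairs _ _ _ p_pair])
    qed (use room[OF l] in \<open>auto simp: disjoint_family_on_def vertex_pairs_def\<close>)
    then show ?thesis using p_scale[of "l + 2"] by simp
  qed
  have pr: "measure_pmf.prob L (right l) = (1 - a (l + 2)) ^ f l" if l: "l \<in> {1..t - 2}" for l
  proof -
    have "measure_pmf.prob L (right l) =
        (\<Prod>x\<in>{1..f l}. 1 - (\<Prod>e\<in>{(n + 1 - x - f (l + 2), n + 1 - x)}. p (snd e - fst e)))"
      unfolding L_def edge_law_def right_def
    proof (rule prob_no_group_complete[OF finite_vertex_pairs _ _ _ p_pair])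
    qed (use room[OF l] in \<open>auto simp: disjoint_family_on_def vertex_pairs_def\<close>)
    also have "\<dots> = (\<Prod>x\<in>{1..f l}. 1 - a (l + 2))"
      using p_scale[of "l + 2"] room[OF l] by (intro prod.cong refl) auto
    finally show ?thesis by simp
  qed
  have "\<not> has_uncrossed_ladder n X"
    if X: "X \<in> set_pmf L" and good: "\<And>l. l \<in> {1..t - 2} \<Longrightarrow> X \<notin> left l \<and> X \<notin> right l" for X
  proof
    assume "has_uncrossed_ladder n X"
    then obtain v0 v1 v2 v3 where v: "v0 \<in> {1..n}" "v1 \<in> {1..n}" "v2 \<in> {1..n}" "v3 \<in> {1..n}"
      and lad: "uncrossed_ladder n (\<lambda>v w. X (min v w, max v w)) v0 v1 v2 v3"
      unfolding has_uncrossed_ladder_def by blast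
    have lt: "v0 < v1" "v1 < v2" "v2 < v3" using lad by (simp_all add: uncrossed_ladder_def)
    have no_right: "\<not> X (x, z)" if "x \<in> {1..n}" "z \<in> {1..n}" "x \<le> v1" "v3 < z" for x z
    proof -
      have "\<not> X (min x z, max x z)" using lad that unfolding uncrossed_ladder_def by blast
      moreover have "x < z" using that lt by linarith
      ultimately show ?thesis by simp
    qed
    have no_left: "\<not> X (x, z)" if "x \<in> {1..n}" "z \<in> {1..n}" "x < v0" "v2 \<le> z" for x z
    proof -
      have "\<not> X (min x z, max x z)" using lad that unfolding uncrossed_ladder_def by blast
      moreover have "x < z" using that lt by linarith
      ultimately show ?thesis by simp
    qed
    obtain s where s: "s \<ge> 1" "v1 = v0 + f (2 * s - 1)" "v2 = v1 + f (2 * s - 1)" "v3 = v2 + f (2 * s - 1)"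
      using ladder_equally_spaced[OF X[unfolded L_def] lad] .
    have d2: "2 * f (2 * s - 1) = f (2 * s)" using f_even[OF s(1)] by simp
    have "2 * s < t"
    proof (rule ccontr)
      assume "\<not> 2 * s < t"
      moreover have "t \<noteq> 2 * s" using t by auto
      ultimately have "f (Suc t) \<le> f (2 * s)" by (intro f_le) auto
      moreover have "f (t - 2) < f t" using t by (intro f_less) auto
      ultimately show False using f_Suc[of t] t v s d2 unfolding n_def by simp
    qed
    show False
    proof (cases "2 * v1 \<le> n")
      case True
      obtain l where l: "1 \<le> l" "l \<le> t - 2" "f l \<le> v1" "v1 + f (2 * s) < f (l + 2)"
        using level_between[OF t(1) s(1) \<open>2 * s < t\<close>, of v1] True s(2) by (auto simp: n_def)
      then obtain x where x: "x \<in> {1..f l}" "X (x, x + f (l + 2))"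
        using good[of l] by (auto simp: left_def)
      have "x + f (l + 2) \<le> n" using x room[of l] l by auto
      then show False using no_right[of x "x + f (l + 2)"] x l s d2 by auto
    next
      case False
      \<comment> \<open>The reflection \<open>v \<mapsto> n + 1 - v\<close> exchanges the two halves.\<close>
      define z where "z = n + 1 - v2"
      have v3: "v3 \<le> n" and zv: "z + v2 = n + 1" using v by (auto simp: z_def)
      have z: "2 * z \<le> n" "f (2 * s - 1) \<le> z" using False v3 zv lt s by linarith+
      obtain l where l: "1 \<le> l" "l \<le> t - 2" "f l \<le> z" "z + f (2 * s) < f (l + 2)"
        using level_between[OF t(1) s(1) \<open>2 * s < t\<close>, of z] z by (auto simp: n_def)
      then obtain x where x: "x \<in> {1..f l}" "X (n + 1 - x - f (l + 2), n + 1 - x)"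
        using good[of l] by (auto simp: right_def)
      have "x + f (l + 2) \<le> n" using x room[of l] l by auto
      have "n + 1 < v0 + f (l + 2)" using l(4) s d2 zv by linarith
      then have "n + 1 - x - f (l + 2) < v0"
        using \<open>x + f (l + 2) \<le> n\<close> x(1) by simp
      moreover have "v2 \<le> n + 1 - x" using x(1) l zv by auto
      moreover have "1 \<le> x" using x(1) by simp
      then have "n + 1 - x - f (l + 2) \<in> {1..n}" "n + 1 - x \<in> {1..n}"
        using \<open>x + f (l + 2) \<le> n\<close> unfolding atLeastAtMost_iff by linarith+
      ultimately show False using no_left x(2) by blast
    qed
  qed
  then have "measure_pmf.prob L {X. has_uncrossed_ladder n X} \<le> measure_pmf.prob L {} +
      measure_pmf.prob L (\<Union>l\<in>{1..t - 2}. left l \<union> right l)"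
    by (intro prob_le_sum) blast
  then have "measure_pmf.prob L {X. has_uncrossed_ladder n X} \<le> measure_pmf.prob L (\<Union>l\<in>{1..t - 2}. left l \<union> right l)"
    by simp
  also have "\<dots> \<le> (\<Sum>l\<in>{1..t - 2}. measure_pmf.prob L (left l \<union> right l))"
    by (intro measure_pmf.finite_measure_subadditive_finite) auto
  also have "\<dots> \<le> (\<Sum>l\<in>{1..t - 2}. measure_pmf.prob L (left l) + measure_pmf.prob L (right l))"
    by (intro sum_mono measure_Un_le) auto
  also have "\<dots> = (\<Sum>l\<in>{1..t - 2}. 2 * (1 - a (l + 2)) ^ f l)"
    by (intro sum.cong refl) (simp add: pl pr)
  finally show ?thesis
    unfolding Prob_ladder_sentence L_def n_def .
qed

end

lemma power_le_small:
  fixes x c :: real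
  assumes "0 \<le> x" "x < 1" "c > 0"
  obtains N where "\<And>n. n \<ge> N \<Longrightarrow> x ^ n \<le> c"
proof -
  obtain N where "x ^ N < c" using real_arch_pow_inv[OF assms(3,2)] by blast
  then have "x ^ n \<le> c" if "n \<ge> N" for n
    using power_decreasing[OF that, of x] assms by simp
  then show thesis by (rule that)
qed

section \<open>Oscillation\<close>

text \<open>
  The probabilities \<open>a\<close> are known before the lengths are chosen, so \<open>f l\<close> can be made as large as
  \<open>a l\<close>, \<open>a (l + 1)\<close> and \<open>a (l + 2)\<close> require. Then an uncrossed ladder exists on \<open>4 * f (2 * s + 1)\<close>
  vertices with probability tending to 1 as \<open>s\<close> grows, while the failure probabilities in the upper
  bound sum to at most \<open>\<epsilon>\<close> over all levels at once.
\<close>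

theorem ex_oscillating:
  fixes a :: "nat \<Rightarrow> real" and \<epsilon> :: real
  assumes a: "\<And>i. i \<ge> 1 \<Longrightarrow> 0 < a i \<and> a i \<le> 1" and "\<epsilon> > 0"
  obtains p where "zero_extension_of p a"
    "limsup (\<lambda>n. ereal (Prob n p ladder_sentence)) = 1"
    "liminf (\<lambda>n. ereal (Prob n p ladder_sentence)) \<le> ereal \<epsilon>"
proof -
  \<comment> \<open>The probability that a given ladder on levels \<open>i\<close> and \<open>i + 1\<close> is incomplete.\<close>
  define y where "y i = 1 - a i ^ 3 * a (i + 1) ^ 2" for i
  have y: "0 \<le> y i \<and> y i < 1" if "i \<ge> 1" for i
  proof -
    have "0 < a i ^ 3 * a (i + 1) ^ 2" using a[of i] a[of "i + 1"] that by simp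
    moreover have "a i ^ 3 * a (i + 1) ^ 2 \<le> 1"
      using a[of i] a[of "i + 1"] that by (intro mult_le_one power_le_one) auto
    ultimately show ?thesis by (simp add: y_def)
  qed
  \<comment> \<open>Twice the sum of \<open>\<epsilon> / 2 ^ (i + 1)\<close> over all \<open>i \<ge> 1\<close> is \<open>\<epsilon>\<close>.\<close>
  have "\<exists>N. \<forall>n\<ge>N. (1 - a (i + 2)) ^ n \<le> \<epsilon> / 2 ^ (i + 1) \<and> (i \<ge> 1 \<longrightarrow> y i ^ n \<le> 1 / real (i + 1))" for i
  proof -
    obtain N1 where N1: "\<And>n. n \<ge> N1 \<Longrightarrow> (1 - a (i + 2)) ^ n \<le> \<epsilon> / 2 ^ (i + 1)"
      using power_le_small[of "1 - a (i + 2)" "\<epsilon> / 2 ^ (i + 1)"] a[of "i + 2"] \<open>\<epsilon> > 0\<close> by auto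
    show ?thesis
    proof (cases "i \<ge> 1")
      case True
      obtain N2 where "\<And>n. n \<ge> N2 \<Longrightarrow> y i ^ n \<le> 1 / real (i + 1)"
        using power_le_small[of "y i" "1 / real (i + 1)"] y[OF True] by auto
      then show ?thesis using N1 by (intro exI[of _ "max N1 N2"]) auto
    qed (use N1 in auto)
  qed
  then obtain R where R: "\<And>i n. n \<ge> R i \<Longrightarrow> (1 - a (i + 2)) ^ n \<le> \<epsilon> / 2 ^ (i + 1)"
    "\<And>i n. n \<ge> R i \<Longrightarrow> i \<ge> 1 \<Longrightarrow> y i ^ n \<le> 1 / real (i + 1)"
    by metis
  obtain f where "scales f" and fR: "\<And>i. i \<ge> 1 \<Longrightarrow> R i \<le> f i"
    using ex_scales[of R] by blast
  interpret scales f by fact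
  define p where "p j = (if j \<in> f ` {1..} then a (inv_into {1..} f j) else 0)" for j
  have inj: "inj_on f {1..}" by (rule inj_onI) (use f_inj in auto)
  have p_f: "p (f i) = a i" if "i \<ge> 1" for i
    using that inv_into_f_f[OF inj, of i] by (simp add: p_def)
  interpret spread_sequence f a p
    by unfold_locales (use a p_f in \<open>auto simp: p_def\<close>)
  define P where "P n = Prob n p ladder_sentence" for n
  have "zero_extension_of p a"
    unfolding zero_extension_of_def
  proof (intro exI[of _ f] conjI allI impI)
    show "f \<in> {1..} \<rightarrow> {1..}" using f_pos by (auto simp: Suc_le_eq)
    show "strict_mono_on {1..} f" by (rule strict_mono_onI) (use f_less in auto)
  qed (use p_f in \<open>auto simp: p_def\<close>)
  moreover have "limsup (\<lambda>n. ereal (P n)) = 1"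
  proof (rule antisym)
    show "limsup (\<lambda>n. ereal (P n)) \<le> 1"
      by (rule Limsup_bounded) (simp add: P_def Prob_def)
    define r where "r s = 4 * f (2 * s + 1)" for s
    have mono: "strict_mono r"
      unfolding strict_mono_def r_def using f_less by simp
    have low: "1 - 1 / real (s + 1) \<le> P (r s)" for s
    proof -
      have "y (2 * s + 1) ^ f (2 * s + 1) \<le> 1 / real (2 * s + 1 + 1)"
        by (rule R(2)) (use fR in auto)
      also have "\<dots> \<le> 1 / real (s + 1)" by (simp add: frac_le)
      finally show ?thesis
        using Prob_ladder_lower[of "Suc s"] by (simp add: P_def r_def y_def)
    qed
    have "(\<lambda>s. P (r s)) \<longlonglongrightarrow> 1"
    proof (rule tendsto_sandwich)
      show "\<forall>\<^sub>F s in sequentially. 1 - 1 / real (s + 1) \<le> P (r s)" using low by simp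
      show "\<forall>\<^sub>F s in sequentially. P (r s) \<le> 1" by (simp add: P_def Prob_def)
      have "(\<lambda>s. 1 / real (Suc s)) \<longlonglongrightarrow> 0" using LIMSEQ_inverse_real_of_nat by (simp add: inverse_eq_divide)
      from tendsto_diff[OF tendsto_const[of 1] this] show "(\<lambda>s. 1 - 1 / real (s + 1)) \<longlonglongrightarrow> 1" by simp
    qed simp
    then have "(\<lambda>s. ereal (P (r s))) \<longlonglongrightarrow> ereal 1" by simp
    from lim_imp_Limsup[OF _ this] have "limsup ((\<lambda>n. ereal (P n)) \<circ> r) = 1"
      by (simp add: o_def one_ereal_def)
    then show "1 \<le> limsup (\<lambda>n. ereal (P n))"
      using limsup_subseq_mono[OF mono, of "\<lambda>n. ereal (P n)"] by simp
  qed
  moreover have "liminf (\<lambda>n. ereal (P n)) \<le> ereal \<epsilon>"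
  proof -
    define r where "r s = f (2 * s + 3) + f (2 * s + 1)" for s
    have mono: "strict_mono r"
      unfolding strict_mono_def r_def using f_less by (simp add: add_strict_mono)
    have up: "P (r s) \<le> \<epsilon>" for s
    proof -
      have "P (r s) \<le> (\<Sum>l\<in>{1..2 * s + 1}. 2 * (1 - a (l + 2)) ^ f l)"
      proof -
        have "odd (2 * s + 3)" "3 \<le> 2 * s + 3" and shift: "2 * s + 3 - 2 = 2 * s + 1" by simp_all
        from Prob_ladder_upper[OF this(1,2)] show ?thesis unfolding shift P_def r_def .
      qed
      also have "\<dots> \<le> (\<Sum>l\<in>{1..2 * s + 1}. \<epsilon> * (1 / 2) ^ l)"
      proof (rule sum_mono)
        fix l assume "l \<in> {1..2 * s + 1}"
        then have "(1 - a (l + 2)) ^ f l \<le> \<epsilon> / 2 ^ (l + 1)" by (intro R(1) fR) auto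
        then show "2 * (1 - a (l + 2)) ^ f l \<le> \<epsilon> * (1 / 2) ^ l" by (simp add: power_one_over field_simps)
      qed
      also have "\<dots> = \<epsilon> * (\<Sum>l\<in>{1..2 * s + 1}. (1 / 2) ^ l)" by (rule sum_distrib_left[symmetric])
      also have "\<dots> \<le> \<epsilon> * 1"
      proof (rule mult_left_mono)
        have "(\<Sum>l\<in>{1..m}. (1 / 2 :: real) ^ l) = 1 - (1 / 2) ^ m" for m
          by (induction m) (simp_all add: field_simps)
        from this[of "2 * s + 1"] show "(\<Sum>l\<in>{1..2 * s + 1}. (1 / 2 :: real) ^ l) \<le> 1"
          using zero_le_power[of "1 / 2 :: real" "2 * s + 1"] by linarith
      qed (use \<open>\<epsilon> > 0\<close> in simp)
      finally show ?thesis by simp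
    qed
    have "liminf (\<lambda>n. ereal (P n)) \<le> liminf ((\<lambda>n. ereal (P n)) \<circ> r)"
      by (rule liminf_subseq_mono[OF mono])
    also have "\<dots> \<le> ereal \<epsilon>"
      by (rule Liminf_le) (use up in simp_all)
    finally show ?thesis .
  qed
  ultimately show thesis unfolding P_def by (rule that)
qed

theorem theorem3:
  shows "(\<forall>p :: nat \<Rightarrow> real.
            (\<forall>i\<ge>1. 0 \<le> p i \<and> p i \<le> 1) \<longrightarrow> finite {i. i \<ge> 1 \<and> p i \<noteq> 0} \<longrightarrow>
            (\<forall>\<psi>. sentence \<psi> \<longrightarrow> convergent (\<lambda>n. Prob n p \<psi>))) \<and>
         (\<forall>(a :: nat \<Rightarrow> real) (\<epsilon> :: real).
            (\<forall>i\<ge>1. 0 < a i \<and> a i \<le> 1) \<longrightarrow> \<epsilon> > 0 \<longrightarrow>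
            (\<exists>p \<psi>. zero_extension_of p a \<and> sentence \<psi> \<and>
               limsup (\<lambda>n. ereal (Prob n p \<psi>)) = 1 \<and>
               liminf (\<lambda>n. ereal (Prob n p \<psi>)) \<le> ereal \<epsilon>))"
proof (intro conjI allI impI)
  fix p :: "nat \<Rightarrow> real" and \<psi>
  assume "finite {i. i \<ge> 1 \<and> p i \<noteq> 0}" "sentence \<psi>"
  then show "convergent (\<lambda>n. Prob n p \<psi>)" by (rule convergent_Prob_finite_support)
next
  fix a :: "nat \<Rightarrow> real" and \<epsilon> :: real
  assume a: "\<forall>i\<ge>1. 0 < a i \<and> a i \<le> 1" and "\<epsilon> > 0"
  then obtain p where "zero_extension_of p a"
    "limsup (\<lambda>n. ereal (Prob n p ladder_sentence)) = 1"
    "liminf (\<lambda>n. ereal (Prob n p ladder_sentence)) \<le> ereal \<epsilon>"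
    using ex_oscillating[of a \<epsilon>] by blast
  then show "\<exists>p \<psi>. zero_extension_of p a \<and> sentence \<psi> \<and>
      limsup (\<lambda>n. ereal (Prob n p \<psi>)) = 1 \<and> liminf (\<lambda>n. ereal (Prob n p \<psi>)) \<le> ereal \<epsilon>"
    using sentence_ladder by blast
qed

end
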